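(* For $n\ge 1$ and $\nu\in\{U,D\}^{n-1}$, the generating function $G_{n,\nu}$ of labeled plane binary trees on $n$ nodes with canopy $\nu$ by left ascents, left descents, right ascents and right descents satisfies $$G_{n,\nu}=\sum_{\substack{\pi^\ast\in\mathrm{mNC}^*(n,\nu)\\ \pi^\ast=B_1/\cdots/B_k}}\mathrm{wt}(\pi^\ast)\,r_{c(B_1)}r_{c(B_2)}\cdots r_{c(B_k)},$$ where the sum is over all augmented interlacing partitions $\pi^\ast$ of $[n]$ with $w(\pi^\ast)=\nu$, with blocks $B_1,\dots,B_k$.
   Context: **Trees.** A (plane binary) tree is a rooted tree in which every node has at most one left child and at most one right child (it may have only one of the two), and no other children. A labeled tree is a tree whose nodes are labeled with positive integers, repetitions allowed. Write $v^\ell$ for the label of $v$. If $v$ is the left child of $w$, the edge is a left ascent if $v^\ell\le w^\ell$ and a left descent otherwise. If $w$ is the right child of $v$, the edge is a right ascent if $v^\ell\le w^\ell$ and a right descent otherwise. $\mathrm{lasc},\mathrm{ldes},\mathrm{rasc},\mathrm{rdes}$ count these edges. Inorder recursively visits the left subtree, then the root, then the right subtree. The canopy of a tree with nodes $v_1,\dots,v_n$ in inorder is the word of length $n-1$ whose $i$th letter is $D$ if $v_i$ has a right child and $U$ otherwise. With commuting indeterminates $\mathsf{x}=\{x_1,x_2,\dots\}$ and $\bar\lambda,\lambda,\bar\rho,\rho$, and $\mathsf{x}^T=\prod_{v\in T}x_{v^\ell}$, put $G_{n,\nu}=\sum_T\bar\lambda^{\mathrm{lasc}(T)}\lambda^{\mathrm{ldes}(T)}\bar\rho^{\,\mathrm{rasc}(T)}\rho^{\,\mathrm{rdes}(T)}\,\mathsf{x}^T$,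 summed over labeled trees $T$ on $n$ nodes with canopy $\nu$. **Ribbon Schur functions.** For a composition $\alpha=(\alpha_1,\dots,\alpha_k)\vDash n$ let $\mathrm{set}(\alpha)=\{\alpha_1,\alpha_1+\alpha_2,\dots,\alpha_1+\cdots+\alpha_{k-1}\}$, and $r_\alpha=\sum_w x_{w_1}\cdots x_{w_n}$ over words $w$ of $n$ positive integers with $\{i:w_i>w_{i+1}\}=\mathrm{set}(\alpha)$. **Marked interlacing partitions.** A set partition $\pi$ of $[n]$ is noncrossing if there are no $a<b<c<d$ with $a,c$ in one block and $b,d$ in a different block. Write $\pi=B_1/\cdots/B_k$ with blocks in increasing order of minima. Let $\max(\pi)$, $\min(\pi)$ be the sets of maxima and minima of the blocks. A noncrossing $\pi$ is interlacing if $i\in\max(\pi)$ implies $i+1\notin\min(\pi)$ for all $i$ (this forces $1$ and $n$ to be in the same block). For $i\notin\max(\pi)$ let $j$ be the next larger element in the block of $i$; there is an arc from $i$ to $j$. If $j=i+1$ then $i$ is a stepper and the arc is short; if $j\ge i+2$ then $i$ is a jumper and the arc is long. A marked interlacing partition is an interlacing noncrossing partition together with a subset of marked elements of $[n]\setminus\max(\pi)$. For a block $B$, listed increasingly, $c(B)$ is the composition of $|B|$ recording the sizes of the consecutive pieces obtained by breaking $B$ after each marked element. **Augmented interlacing partitions.** An augmented interlacing partition $\pi^\ast$ is a marked interlacing partition together with a label $U$ or $D$ on each short arc. Its weight is $$\mathrm{wt}(\pi^\ast)=\bar\lambda^{\mathrm{saU}}\lambda^{\mathrm{sdU}}\bar\rho^{\,\mathrm{saD}}\rho^{\,\mathrm{sdD}}(\bar\lambda\bar\rho)^{\mathrm{ja}}(\lambda\rho)^{\mathrm{jd}},$$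 where $\mathrm{saU}$ (resp. $\mathrm{saD}$) is the number of unmarked steppers whose short arc is labeled $U$ (resp. $D$), $\mathrm{sdU}$ (resp. $\mathrm{sdD}$) is the number of marked steppers whose short arc is labeled $U$ (resp. $D$), and $\mathrm{ja}$, $\mathrm{jd}$ are the numbers of unmarked and marked jumpers. The word $w(\pi^\ast)\in\{U,D\}^{n-1}$ is defined recursively, with $\hat w(\pi^\ast)=D\,w(\pi^\ast)\,U$. If $\pi^\ast$ has a single block, $w(\pi^\ast)$ is the word of labels of the short arcs read from left to right. Otherwise let $B_1$ be the block containing $1$ and $n$, and split $B_1$ into the maximal sets $C_1,\dots,C_p$ (from left to right) of elements connected by short arcs. For a set $C_i$ let $w(C_i)$ be the word of labels of its short arcs read from left to right. For $1\le i\le p-1$ let $\pi^\ast_i$ be the augmented interlacing partition induced by $\pi^\ast$ on the integers strictly between $\max(C_i)$ and $\min(C_{i+1})$. Then $$w(\pi^\ast)=w(C_1)\,\hat w(\pi^\ast_1)\,w(C_2)\,\hat w(\pi^\ast_2)\cdots w(C_{p-1})\,\hat w(\pi^\ast_{p-1})\,w(C_p).$$ $\mathrm{mNC}^*(n,\nu)$ is the set of augmented interlacing partitions $\pi^\ast$ of $[n]$ with $w(\pi^\ast)=\nu$. *)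

theory Defs
  imports "HOL-Library.Multiset" "HOL-Library.Tree" "HOL-Library.Disjoint_Sets"
begin

section \<open>Formal power series in an arbitrary set of commuting indeterminates\<close>

text \<open>A monomial is a finite multiset of indeterminates, a series an arbitrary function from
  monomials to coefficients.\<close>

typedef ('v, 'a) mfps = "UNIV :: ('v multiset \<Rightarrow> 'a) set"
  morphisms mcoeff Abs_mfps by simp

lemma mcoeff_Abs_mfps [simp]: "mcoeff (Abs_mfps f) = f"
  by (simp add: Abs_mfps_inverse)

lemma mfps_eqI: "(\<And>m. mcoeff f m = mcoeff g m) \<Longrightarrow> f = g"
  by (metis ext mcoeff_inject)

lemma finite_subset_mset: "finite {A. A \<subseteq># (M :: 'v multiset)}"
proof (induction M)
  case (add x M)
  have "{A. A \<subseteq># add_mset x M} \<subseteq> {A. A \<subseteq># M} \<union> add_mset x ` {A. A \<subseteq># M}"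
  proof
    fix A assume "A \<in> {A. A \<subseteq># add_mset x M}"
    then have A: "A \<subseteq># add_mset x M" by simp
    show "A \<in> {A. A \<subseteq># M} \<union> add_mset x ` {A. A \<subseteq># M}"
    proof (cases "x \<in># A")
      case True
      then obtain A' where "A = add_mset x A'" by (metis insert_DiffM)
      with A show ?thesis by simp
    next
      case False
      have "count A y \<le> count M y" for y
        using mset_subset_eq_count[OF A, of y] False
        by (cases "y = x") (simp_all add: not_in_iff)
      then show ?thesis by (simp add: subseteq_mset_def)
    qed
  qed
  then show ?case by (rule finite_subset) (simp add: add.IH)
qed simp

instantiation mfps :: (type, comm_ring_1) comm_ring_1
begin

definition "0 = Abs_mfps (\<lambda>_. 0)"
definition "1 = Abs_mfps (\<lambda>m. if m = {#} then 1 else 0)"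
definition "f + g = Abs_mfps (\<lambda>m. mcoeff f m + mcoeff g m)"
definition "- f = Abs_mfps (\<lambda>m. - mcoeff f m)"
definition "f - g = Abs_mfps (\<lambda>m. mcoeff f m - mcoeff g m)"
definition "f * g = Abs_mfps (\<lambda>m. \<Sum>a | a \<subseteq># m. mcoeff f a * mcoeff g (m - a))"

instance
proof
  fix f g h :: "('a, 'b) mfps"
  show "f * g * h = f * (g * h)"
  proof (rule mfps_eqI)
    fix m
    have "mcoeff (f * g * h) m =
        (\<Sum>(a, b) \<in> Sigma {a. a \<subseteq># m} (\<lambda>a. {b. b \<subseteq># a}).
          mcoeff f b * mcoeff g (a - b) * mcoeff h (m - a))"
      by (simp add: times_mfps_def sum_distrib_right sum.Sigma finite_subset_mset)
    also have "\<dots> = (\<Sum>(b, c) \<in> Sigma {b. b \<subseteq># m} (\<lambda>b. {c. c \<subseteq># m - b}).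
          mcoeff f b * (mcoeff g c * mcoeff h (m - b - c)))"
      by (rule sum.reindex_bij_witness
            [of _ "\<lambda>(b, c). (b + c, b)" "\<lambda>(a, b). (b, a - b)"])
         (auto simp: mult.assoc subset_mset.le_diff_conv2 subset_mset.add_diff_inverse
           add.commute intro: subset_mset.order_trans)
    also have "\<dots> = mcoeff (f * (g * h)) m"
      by (simp add: times_mfps_def sum_distrib_left sum.Sigma finite_subset_mset)
    finally show "mcoeff (f * g * h) m = mcoeff (f * (g * h)) m" .
  qed
  show "f * g = g * f"
  proof (rule mfps_eqI)
    fix m :: "'a multiset"
    have dd: "m - (m - a) = a" if "a \<subseteq># m" for a
      using that by (simp add: multiset_eq_iff subseteq_mset_def)
    show "mcoeff (f * g) m = mcoeff (g * f) m"
      unfolding times_mfps_def mcoeff_Abs_mfps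
      by (rule sum.reindex_bij_witness [of _ "\<lambda>a. m - a" "\<lambda>a. m - a"])
         (auto simp: dd mult.commute)
  qed
  show "1 * f = f"
  proof (rule mfps_eqI)
    fix m
    have "mcoeff (1 * f) m = (\<Sum>a | a \<subseteq># m. if a = {#} then mcoeff f m else 0)"
      unfolding times_mfps_def one_mfps_def mcoeff_Abs_mfps by (rule sum.cong) auto
    then show "mcoeff (1 * f) m = mcoeff f m"
      by (simp add: finite_subset_mset)
  qed
  show "(f + g) * h = f * h + g * h"
    by (rule mfps_eqI) (simp add: times_mfps_def plus_mfps_def distrib_right sum.distrib)
  show "(0 :: ('a, 'b) mfps) \<noteq> 1"
  proof
    assume "(0 :: ('a, 'b) mfps) = 1"
    then have "mcoeff (0 :: ('a, 'b) mfps) {#} = mcoeff 1 {#}" by simp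
    then show False by (simp add: zero_mfps_def one_mfps_def)
  qed
  show "f + g + h = f + (g + h)" "f + g = g + f" "0 + f = f" "- f + f = 0" "f - g = f + - g"
    by (rule mfps_eqI; simp add: plus_mfps_def zero_mfps_def uminus_mfps_def minus_mfps_def
        add.assoc add.commute)+
qed

end

definition mmonom :: "'v multiset \<Rightarrow> ('v, 'a :: comm_ring_1) mfps" where
  "mmonom k = Abs_mfps (\<lambda>m. if m = k then 1 else 0)"

definition mvar :: "'v \<Rightarrow> ('v, 'a :: comm_ring_1) mfps" where
  "mvar v = mmonom {#v#}"

text \<open>Infinite sums are formed coefficientwise; this is meaningful for families satisfying
  \<open>mfps_summable\<close>, i.e. those in which only finitely many members contribute to each coefficient.\<close>

definition mfps_summable :: "('i \<Rightarrow> ('v, 'a :: comm_ring_1) mfps) \<Rightarrow> 'i set \<Rightarrow> bool" where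
  "mfps_summable f A \<longleftrightarrow> (\<forall>m. finite {i \<in> A. mcoeff (f i) m \<noteq> 0})"

definition mfps_sum :: "('i \<Rightarrow> ('v, 'a :: comm_ring_1) mfps) \<Rightarrow> 'i set \<Rightarrow> ('v, 'a) mfps" where
  "mfps_sum f A = Abs_mfps (\<lambda>m. \<Sum>i | i \<in> A \<and> mcoeff (f i) m \<noteq> 0. mcoeff (f i) m)"


section \<open>Labeled plane binary trees\<close>

text \<open>All series have integer coefficients and live in one ring, whose indeterminates are
  $\bar\lambda, \lambda, \bar\rho, \rho$ and $x_1, x_2, \ldots$; the index \<open>0\<close> of \<open>X\<close> never occurs,
  because labels are positive.\<close>

datatype indet = Lambda_bar | Lambda | Rho_bar | Rho | X nat

type_synonym series = "(indet, int) mfps"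

datatype letter = U | D

text \<open>\<open>Leaf\<close> stands for an absent child, so \<open>size\<close> counts the nodes.\<close>

definition labeled_trees :: "nat \<Rightarrow> nat tree set" where
  "labeled_trees n = {T. size T = n \<and> (\<forall>v \<in> set_tree T. 0 < v)}"

fun lasc :: "nat tree \<Rightarrow> nat" where
  "lasc Leaf = 0"
| "lasc (Node l a r) = lasc l + lasc r + (if l \<noteq> Leaf \<and> value l \<le> a then 1 else 0)"

fun ldes :: "nat tree \<Rightarrow> nat" where
  "ldes Leaf = 0"
| "ldes (Node l a r) = ldes l + ldes r + (if l \<noteq> Leaf \<and> value l > a then 1 else 0)"

fun rasc :: "nat tree \<Rightarrow> nat" where
  "rasc Leaf = 0"
| "rasc (Node l a r) = rasc l + rasc r + (if r \<noteq> Leaf \<and> a \<le> value r then 1 else 0)"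

fun rdes :: "nat tree \<Rightarrow> nat" where
  "rdes Leaf = 0"
| "rdes (Node l a r) = rdes l + rdes r + (if r \<noteq> Leaf \<and> a > value r then 1 else 0)"

text \<open>A node is represented by the subtree rooted at it.\<close>

fun inorder_nodes :: "'a tree \<Rightarrow> 'a tree list" where
  "inorder_nodes Leaf = []"
| "inorder_nodes (Node l a r) = inorder_nodes l @ [Node l a r] @ inorder_nodes r"

definition canopy :: "'a tree \<Rightarrow> letter list" where
  "canopy T = map (\<lambda>v. if right v \<noteq> Leaf then D else U) (butlast (inorder_nodes T))"

definition tree_weight :: "nat tree \<Rightarrow> series" where
  "tree_weight T = mvar Lambda_bar ^ lasc T * mvar Lambda ^ ldes T
     * mvar Rho_bar ^ rasc T * mvar Rho ^ rdes T * (\<Prod>a \<leftarrow> inorder T. mvar (X a))"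

definition tree_gf :: "nat \<Rightarrow> letter list \<Rightarrow> series" where
  "tree_gf n \<nu> = mfps_sum tree_weight {T \<in> labeled_trees n. canopy T = \<nu>}"


section \<open>Ribbon Schur functions\<close>

definition comp_set :: "nat list \<Rightarrow> nat set" where
  "comp_set \<alpha> = {sum_list (take j \<alpha>) |j. 1 \<le> j \<and> j < length \<alpha>}"

text \<open>Positions in words are counted from 1, whereas \<open>!\<close> counts from 0.\<close>

definition descent_set :: "nat list \<Rightarrow> nat set" where
  "descent_set w = {i. 1 \<le> i \<and> i < length w \<and> w ! (i - 1) > w ! i}"

definition ribbon :: "nat list \<Rightarrow> series" where
  "ribbon \<alpha> = mfps_sum (\<lambda>w. \<Prod>a \<leftarrow> w. mvar (X a))
     {w. length w = sum_list \<alpha> \<and> (\<forall>a \<in> set w. 0 < a) \<and> descent_set w = comp_set \<alpha>}"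


section \<open>Augmented interlacing partitions\<close>

definition noncrossing :: "nat set set \<Rightarrow> bool" where
  "noncrossing \<pi> \<longleftrightarrow> \<not> (\<exists>A \<in> \<pi>. \<exists>B \<in> \<pi>. A \<noteq> B \<and>
     (\<exists>a b c d. a < b \<and> b < c \<and> c < d \<and> a \<in> A \<and> c \<in> A \<and> b \<in> B \<and> d \<in> B))"

definition interlacing :: "nat set set \<Rightarrow> bool" where
  "interlacing \<pi> \<longleftrightarrow> (\<forall>i \<in> Max ` \<pi>. i + 1 \<notin> Min ` \<pi>)"

definition arcs :: "nat set set \<Rightarrow> (nat \<times> nat) set" where
  "arcs \<pi> = {(i, j). \<exists>B \<in> \<pi>. i \<in> B \<and> j \<in> B \<and> i < j \<and> (\<forall>k \<in> B. \<not> (i < k \<and> k < j))}"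

definition steppers :: "nat set set \<Rightarrow> nat set" where
  "steppers \<pi> = {i. (i, i + 1) \<in> arcs \<pi>}"

definition jumpers :: "nat set set \<Rightarrow> nat set" where
  "jumpers \<pi> = {i. \<exists>j \<ge> i + 2. (i, j) \<in> arcs \<pi>}"

text \<open>A short arc is identified with the stepper at its left end.\<close>

record aug_partition =
  blocks :: "nat set set"
  marked :: "nat set"
  arc_label :: "nat \<rightharpoonup> letter"

definition aug_interlacing :: "nat \<Rightarrow> aug_partition set" where
  "aug_interlacing n = {P.
     partition_on {1..n} (blocks P) \<and> noncrossing (blocks P) \<and> interlacing (blocks P) \<and>
     marked P \<subseteq> {1..n} - Max ` blocks P \<and> dom (arc_label P) = steppers (blocks P)}"

definition short_arcs :: "aug_partition \<Rightarrow> letter \<Rightarrow> nat set" where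
  "short_arcs P c = {i \<in> steppers (blocks P). arc_label P i = Some c}"

definition aug_weight :: "aug_partition \<Rightarrow> series" where
  "aug_weight P =
     mvar Lambda_bar ^ card (short_arcs P U - marked P)
     * mvar Lambda ^ card (short_arcs P U \<inter> marked P)
     * mvar Rho_bar ^ card (short_arcs P D - marked P)
     * mvar Rho ^ card (short_arcs P D \<inter> marked P)
     * (mvar Lambda_bar * mvar Rho_bar) ^ card (jumpers (blocks P) - marked P)
     * (mvar Lambda * mvar Rho) ^ card (jumpers (blocks P) \<inter> marked P)"

text \<open>Break a list into consecutive nonempty pieces after each element satisfying \<open>Q\<close>.\<close>

fun break_after :: "('a \<Rightarrow> bool) \<Rightarrow> 'a list \<Rightarrow> 'a list list" where
  "break_after Q [] = []"
| "break_after Q [x] = [[x]]"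
| "break_after Q (x # y # zs) =
     (if Q x then [x] # break_after Q (y # zs)
      else (x # hd (break_after Q (y # zs))) # tl (break_after Q (y # zs)))"

definition block_comp :: "aug_partition \<Rightarrow> nat set \<Rightarrow> nat list" where
  "block_comp P B = map length (break_after (\<lambda>i. i \<in> marked P) (sorted_list_of_set B))"

definition ground :: "aug_partition \<Rightarrow> nat set" where
  "ground P = \<Union>(blocks P)"

text \<open>The induced partition keeps its ground set and is not renumbered to \<open>{1..m}\<close>; accordingly the
  role of the block of \<open>1\<close> is played by the block of the least element of the ground set.\<close>

definition first_block :: "aug_partition \<Rightarrow> nat set" where
  "first_block P = \<Union>{B \<in> blocks P. Min (ground P) \<in> B}"

definition induced :: "aug_partition \<Rightarrow> nat set \<Rightarrow> aug_partition" where
  "induced P I = \<lparr>blocks = {B \<inter> I |B. B \<in> blocks P \<and> B \<inter> I \<noteq> {}},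
     marked = marked P \<inter> I, arc_label = arc_label P |` {i \<in> I. i + 1 \<in> I}\<rparr>"

text \<open>The maximal sets of elements of a block connected by short arcs, from left to right, each as
  an increasing list.\<close>

definition short_components :: "nat set \<Rightarrow> nat list list" where
  "short_components B = break_after (\<lambda>i. i + 1 \<notin> B) (sorted_list_of_set B)"

text \<open>The labels of the short arcs within the increasing list \<open>C\<close>.\<close>

definition arc_word :: "aug_partition \<Rightarrow> nat list \<Rightarrow> letter list" where
  "arc_word P C = map (\<lambda>i. the (arc_label P i)) (filter (\<lambda>i. i + 1 \<in> set C) C)"

lemma set_break_after: "C \<in> set (break_after Q xs) \<Longrightarrow> C \<noteq> [] \<and> set C \<subseteq> set xs"
proof (induction Q xs arbitrary: C rule: break_after.induct)
  case (3 Q x y zs)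
  have ne: "break_after Q (y # zs) \<noteq> []" by (cases zs) auto
  have "hd (break_after Q (y # zs)) \<in> set (break_after Q (y # zs))" using ne by simp
  moreover have "set (tl (break_after Q (y # zs))) \<subseteq> set (break_after Q (y # zs))"
    using ne by (meson list.set_sel(2) subsetI)
  ultimately show ?case using 3 by (auto split: if_splits) blast+
qed auto

text \<open>Here \<open>Cs ! i\<close> is $C_{i+1}$, so \<open>last (Cs ! i)\<close> is its maximum and \<open>hd (Cs ! (i + 1))\<close> the
  minimum of the next component.\<close>

function aug_word :: "aug_partition \<Rightarrow> letter list" where
  "aug_word P =
     (if card (blocks P) = 1 then arc_word P (sorted_list_of_set (ground P))
      else let Cs = short_components (first_block P) in
        concat (map (\<lambda>i. arc_word P (Cs ! i) @
            [D] @ aug_word (induced P {last (Cs ! i) <..< hd (Cs ! (i + 1))}) @ [U])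
          [0..<length Cs - 1])
        @ arc_word P (last Cs))"
  by auto
termination
proof (relation "measures [\<lambda>P. if finite (ground P) then 0 else 1, \<lambda>P. card (ground P)]",
    goal_cases)
  case (2 P Cs i)
  let ?x = "last (Cs ! i)" and ?I = "{last (Cs ! i) <..< hd (Cs ! (i + 1))}"
  have i: "i < length Cs" using 2 by auto
  then have "Cs ! i \<in> set Cs" by simp
  then have "Cs ! i \<noteq> [] \<and> set (Cs ! i) \<subseteq> set (sorted_list_of_set (first_block P))"
    unfolding 2 short_components_def by (rule set_break_after)
  then have "?x \<in> first_block P"
    by (metis last_in_set sorted_list_of_set.set_sorted_key_list_of_set subsetD
        sorted_list_of_set.fold_insort_key.infinite empty_iff list.set(1))
  then have x: "?x \<in> ground P" by (auto simp: first_block_def ground_def)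
  have g: "ground (induced P I) = ground P \<inter> I" for I
    by (auto simp: ground_def induced_def)
  have "card (ground P \<inter> ?I) < card (ground P)" if "finite (ground P)"
    using that x by (intro psubset_card_mono) auto
  then show ?case by (auto simp: g)
qed simp

declare aug_word.simps [simp del]

definition mNC_star :: "nat \<Rightarrow> letter list \<Rightarrow> aug_partition set" where
  "mNC_star n \<nu> = {P \<in> aug_interlacing n. aug_word P = \<nu>}"


section \<open>Well-definedness of the sums\<close>

lemma mmonom_mult: "mmonom a * mmonom b = (mmonom (a + b) :: ('v, 'a :: comm_ring_1) mfps)"
proof (rule mfps_eqI)
  fix m
  have "mcoeff (mmonom a * mmonom b :: ('v, 'a) mfps) m =
      (\<Sum>k | k \<subseteq># m. if k = a then (if m = a + b then 1 else 0) else 0)"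
    unfolding times_mfps_def mmonom_def mcoeff_Abs_mfps
    by (rule sum.cong) (auto simp: subset_mset.add_diff_inverse)
  then show "mcoeff (mmonom a * mmonom b :: ('v, 'a) mfps) m = mcoeff (mmonom (a + b)) m"
    by (simp add: finite_subset_mset mmonom_def)
qed

lemma mmonom_empty: "mmonom {#} = 1"
  by (simp add: mmonom_def one_mfps_def)

lemma mvar_power: "\<exists>m. mvar v ^ k = mmonom m"
proof (induction k)
  case 0
  show ?case by (auto intro: exI[of _ "{#}"] simp: mmonom_empty)
next
  case (Suc k)
  then show ?case by (auto simp: mvar_def mmonom_mult)
qed

lemma prod_list_mvar: "(\<Prod>a \<leftarrow> w. mvar (X a)) = mmonom (mset (map X w))"
  by (induction w) (simp_all add: mmonom_empty mvar_def mmonom_mult)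

lemma tree_weight_mmonom: "\<exists>m. tree_weight T = mmonom (m + mset (map X (inorder T)))"
proof -
  obtain a where "mvar Lambda_bar ^ lasc T = (mmonom a :: series)"
    by (rule exE[OF mvar_power])
  moreover obtain b where "mvar Lambda ^ ldes T = (mmonom b :: series)"
    by (rule exE[OF mvar_power])
  moreover obtain c where "mvar Rho_bar ^ rasc T = (mmonom c :: series)"
    by (rule exE[OF mvar_power])
  moreover obtain d where "mvar Rho ^ rdes T = (mmonom d :: series)"
    by (rule exE[OF mvar_power])
  ultimately have "tree_weight T = mmonom (a + b + c + d + mset (map X (inorder T)))"
    unfolding tree_weight_def prod_list_mvar by (simp only: mmonom_mult)
  then show ?thesis by blast
qed

lemma finite_trees: "finite S \<Longrightarrow> finite {T. size T \<le> n \<and> set_tree T \<subseteq> S}"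
proof (induction n)
  case 0
  have "{T. size T \<le> 0 \<and> set_tree T \<subseteq> S} \<subseteq> {Leaf}" by auto
  then show ?case by (rule finite_subset) simp
next
  case (Suc n)
  let ?F = "{T. size T \<le> n \<and> set_tree T \<subseteq> S}"
  have "{T. size T \<le> Suc n \<and> set_tree T \<subseteq> S} \<subseteq>
      insert Leaf ((\<lambda>(l, a, r). Node l a r) ` (?F \<times> S \<times> ?F))"
  proof
    fix T assume "T \<in> {T. size T \<le> Suc n \<and> set_tree T \<subseteq> S}"
    then show "T \<in> insert Leaf ((\<lambda>(l, a, r). Node l a r) ` (?F \<times> S \<times> ?F))"
      by (cases T) (auto simp: image_iff)
  qed
  then show ?case using Suc by (meson finite_SigmaI finite_imageI finite_insert finite_subset)
qed

lemma finite_X_vimage: "finite {a. X a \<in># m}"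
  using finite_vimageI[of "set_mset m" X] by (simp add: vimage_def inj_def)

lemma summable_trees: "mfps_summable tree_weight {T \<in> labeled_trees n. canopy T = \<nu>}"
  unfolding mfps_summable_def
proof
  fix m
  have "{T \<in> {T \<in> labeled_trees n. canopy T = \<nu>}. mcoeff (tree_weight T) m \<noteq> 0} \<subseteq>
      {T. size T \<le> n \<and> set_tree T \<subseteq> {a. X a \<in># m}}"
  proof
    fix T assume T: "T \<in> {T \<in> {T \<in> labeled_trees n. canopy T = \<nu>}. mcoeff (tree_weight T) m \<noteq> 0}"
    obtain k where "tree_weight T = mmonom (k + mset (map X (inorder T)))"
      using tree_weight_mmonom by blast
    with T have "m = k + mset (map X (inorder T))"
      by (auto simp: mmonom_def split: if_splits)
    then have "set_tree T \<subseteq> {a. X a \<in># m}" by auto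
    with T show "T \<in> {T. size T \<le> n \<and> set_tree T \<subseteq> {a. X a \<in># m}}"
      by (auto simp: labeled_trees_def)
  qed
  then show "finite {T \<in> {T \<in> labeled_trees n. canopy T = \<nu>}. mcoeff (tree_weight T) m \<noteq> 0}"
    using finite_trees[OF finite_X_vimage] by (rule finite_subset)
qed

lemma summable_ribbon:
  "mfps_summable (\<lambda>w. (\<Prod>a \<leftarrow> w. mvar (X a)) :: series)
     {w. length w = sum_list \<alpha> \<and> (\<forall>a \<in> set w. 0 < a) \<and> descent_set w = comp_set \<alpha>}"
  unfolding mfps_summable_def
proof
  fix m
  let ?W = "{w \<in> {w. length w = sum_list \<alpha> \<and> (\<forall>a \<in> set w. 0 < a) \<and> descent_set w = comp_set \<alpha>}.
    mcoeff ((\<Prod>a \<leftarrow> w. mvar (X a)) :: series) m \<noteq> 0}"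
  have "?W \<subseteq> {w. set w \<subseteq> {a. X a \<in># m} \<and> length w = sum_list \<alpha>}"
    unfolding prod_list_mvar by (auto simp: mmonom_def split: if_splits)
  then show "finite ?W"
    using finite_lists_length_eq[OF finite_X_vimage] by (rule finite_subset)
qed

lemma finite_mNC_star: "finite (mNC_star n \<nu>)"
proof -
  let ?N = "{1..n}"
  let ?L = "{f :: nat \<rightharpoonup> letter. dom f \<subseteq> ?N \<and> ran f \<subseteq> {U, D}}"
  have "?L = (\<Union>A \<in> Pow ?N. {f. dom f = A \<and> ran f \<subseteq> {U, D}})" by auto
  then have L: "finite ?L"
    by (auto intro!: finite_set_of_finite_maps intro: finite_subset)
  have "mNC_star n \<nu> \<subseteq>
      (\<lambda>(p, m, l). \<lparr>blocks = p, marked = m, arc_label = l\<rparr>) ` (Pow (Pow ?N) \<times> Pow ?N \<times> ?L)"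
  proof
    fix P assume P: "P \<in> mNC_star n \<nu>"
    then have "\<Union>(blocks P) = ?N" "marked P \<subseteq> ?N" "dom (arc_label P) = steppers (blocks P)"
      by (auto simp: mNC_star_def aug_interlacing_def partition_on_def)
    moreover have "steppers (blocks P) \<subseteq> \<Union>(blocks P)"
      by (auto simp: steppers_def arcs_def)
    moreover have "ran (arc_label P) \<subseteq> {U, D}" using letter.exhaust by auto
    ultimately have "(blocks P, marked P, arc_label P) \<in> Pow (Pow ?N) \<times> Pow ?N \<times> ?L" by auto
    then show "P \<in> (\<lambda>(p, m, l). \<lparr>blocks = p, marked = m, arc_label = l\<rparr>) `
        (Pow (Pow ?N) \<times> Pow ?N \<times> ?L)"
      by (intro image_eqI[of _ _ "(blocks P, marked P, arc_label P)"]) simp_all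
  qed
  then show ?thesis using L by (meson finite_Pow_iff finite_SigmaI finite_atLeastAtMost
      finite_imageI finite_subset)
qed

end

theory Submission
  imports Defs
begin

text \<open>Both sides are computed by one recursion on the word \<open>\<nu>\<close>, refined by a label \<open>j\<close>: on the left the
  label of the last node of the tree in inorder, that is, the end of the right spine; on the right
  the last label of the word that expands the ribbon of the block of \<open>1\<close>. The labels of that block
  are then read along its arcs, and an arc from \<open>i\<close> to \<open>j\<close> contributes \<open>\<lambda>[i,j] U\<close> or \<open>\<rho>[i,j] D\<close> if it
  is short and \<open>\<lambda>[i,j] \<rho>[i,j] D w U\<close> if it is long, where \<open>w\<close> is the word below it and
  \<open>\<lambda>[i,j]\<close>, \<open>\<rho>[i,j]\<close> carry a bar iff \<open>i \<le> j\<close>. For trees, splitting off the last node gives the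
  same recursion except that the left subtree of the last node is weighted through its root label
  rather than its last label. These two versions agree because, for every threshold \<open>j\<close>, the right
  spine of a tree crosses \<open>j\<close> upwards and downwards alternately, so that
  \<open>[last \<le> j] - [root \<le> j]\<close> is the number of downward minus the number of upward crossings.\<close>

section \<open>Restricting the set of indeterminates\<close>

text \<open>There is no termwise matching of the two recursions. When the last letter is
  \<open>U\<close>, the trees whose last node is the root and the trees whose last node lies deeper
  do not, in general, have the same sums as the chains ending in a short and in a long arc; only the
  totals agree. Hence sums are compared, not objects. The refinement by a label is forced: the
  weight of the last edge or arc depends on the label just before it, so the unrefined sums satisfy
  no recursion. The last letter is the place to split because it decides whether the last node has a
  left child; for chains, \<open>D\<close> forces a short last arc, while \<open>U\<close> closes
  either kind of arc. The sums run over infinitely many labels. Before any recursion, the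
  indeterminates \<open>X a\<close> with \<open>a > N\<close> are therefore set to 0. This is a ring
  homomorphism, it turns both sides into finite sums over labels in \<open>{1..N}\<close>, and the
  truncations for all \<open>N\<close> together determine a series.\<close>

definition restrict_vars :: "'v set \<Rightarrow> ('v, 'a :: comm_ring_1) mfps \<Rightarrow> ('v, 'a) mfps" where
  "restrict_vars V f = Abs_mfps (\<lambda>m. if set_mset m \<subseteq> V then mcoeff f m else 0)"

lemma mcoeff_restrict_vars:
  "mcoeff (restrict_vars V f) m = (if set_mset m \<subseteq> V then mcoeff f m else 0)"
  by (simp add: restrict_vars_def)

lemma mcoeff_0 [simp]: "mcoeff 0 m = 0"
  by (simp add: zero_mfps_def)

lemma mcoeff_add [simp]: "mcoeff (f + g) m = mcoeff f m + mcoeff g m"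
  by (simp add: plus_mfps_def)

lemma mcoeff_sum: "mcoeff (sum f A) m = (\<Sum>i\<in>A. mcoeff (f i) m)"
  by (induction A rule: infinite_finite_induct) simp_all

lemma restrict_vars_0 [simp]: "restrict_vars V 0 = 0"
  by (rule mfps_eqI) (simp add: mcoeff_restrict_vars)

lemma restrict_vars_add: "restrict_vars V (f + g) = restrict_vars V f + restrict_vars V g"
  by (rule mfps_eqI) (simp add: mcoeff_restrict_vars)

lemma restrict_vars_sum: "restrict_vars V (sum f A) = (\<Sum>i\<in>A. restrict_vars V (f i))"
  by (induction A rule: infinite_finite_induct) (simp_all add: restrict_vars_add)

lemma restrict_vars_mmonom:
  "restrict_vars V (mmonom k) = (if set_mset k \<subseteq> V then mmonom k else 0)"
  by (rule mfps_eqI) (auto simp: mcoeff_restrict_vars mmonom_def)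

lemma restrict_vars_1 [simp]: "restrict_vars V 1 = 1"
  using restrict_vars_mmonom[of V "{#}"] by (simp add: mmonom_empty)

text \<open>In a factorization \<open>m = a + (m - a)\<close> nothing cancels: \<open>m\<close> uses
  only indeterminates of \<open>V\<close> iff both factors do. So setting the others to 0 acts on
  each term of the convolution separately.\<close>

lemma restrict_vars_mult: "restrict_vars V (f * g) = restrict_vars V f * restrict_vars V g"
proof (rule mfps_eqI)
  fix m
  have "mcoeff (restrict_vars V f * restrict_vars V g) m =
      (\<Sum>a | a \<subseteq># m. if set_mset m \<subseteq> V then mcoeff f a * mcoeff g (m - a) else 0)"
    unfolding times_mfps_def mcoeff_Abs_mfps
  proof (rule sum.cong)
    fix a assume "a \<in> {a. a \<subseteq># m}"
    then have "m = a + (m - a)" by simp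
    then have "set_mset m \<subseteq> V \<longleftrightarrow> set_mset a \<subseteq> V \<and> set_mset (m - a) \<subseteq> V"
      by (metis Un_subset_iff set_mset_union)
    then show "mcoeff (restrict_vars V f) a * mcoeff (restrict_vars V g) (m - a) =
        (if set_mset m \<subseteq> V then mcoeff f a * mcoeff g (m - a) else 0)"
      by (simp add: mcoeff_restrict_vars)
  qed simp
  also have "\<dots> = mcoeff (restrict_vars V (f * g)) m"
    by (simp add: mcoeff_restrict_vars times_mfps_def)
  finally show "mcoeff (restrict_vars V (f * g)) m
      = mcoeff (restrict_vars V f * restrict_vars V g) m" by simp
qed

lemma restrict_vars_prod: "restrict_vars V (prod f A) = (\<Prod>i\<in>A. restrict_vars V (f i))"
  by (induction A rule: infinite_finite_induct) (simp_all add: restrict_vars_mult)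

lemma restrict_vars_power: "restrict_vars V (f ^ n) = restrict_vars V f ^ n"
  by (induction n) (simp_all add: restrict_vars_mult)

text \<open>This is how an infinite sum becomes finite: at a monomial over \<open>V\<close>, every
  member outside \<open>B\<close> has coefficient 0, so the support that \<open>mfps_sum\<close>
  adds up lies in \<open>B\<close>.\<close>

lemma restrict_vars_mfps_sum:
  assumes "finite B" "B \<subseteq> A" "\<And>i. i \<in> A - B \<Longrightarrow> restrict_vars V (f i) = 0"
  shows "restrict_vars V (mfps_sum f A) = (\<Sum>i\<in>B. restrict_vars V (f i))"
proof (rule mfps_eqI)
  fix m
  show "mcoeff (restrict_vars V (mfps_sum f A)) m = mcoeff (\<Sum>i\<in>B. restrict_vars V (f i)) m"
  proof (cases "set_mset m \<subseteq> V")
    case True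
    have "mcoeff (f i) m = 0" if "i \<in> A - B" for i
      using assms(3)[OF that] True mcoeff_restrict_vars[of V "f i" m] by simp
    then have "(\<Sum>i | i \<in> A \<and> mcoeff (f i) m \<noteq> 0. mcoeff (f i) m) = (\<Sum>i\<in>B. mcoeff (f i) m)"
      using assms(1,2) by (intro sum.mono_neutral_left) auto
    then show ?thesis
      using True by (simp add: mcoeff_restrict_vars mfps_sum_def mcoeff_sum)
  qed (simp add: mcoeff_restrict_vars mcoeff_sum)
qed

definition vars_upto :: "nat \<Rightarrow> indet set" where
  "vars_upto N = {Lambda_bar, Lambda, Rho_bar, Rho} \<union> X ` {..N}"

text \<open>A monomial is a finite multiset, so some \<open>N\<close> bounds all labels in it, and
  the truncation at this \<open>N\<close> keeps its coefficient.\<close>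

lemma eq_if_restrict_vars_eq:
  fixes f g :: "(indet, 'a :: comm_ring_1) mfps"
  assumes "\<And>N. restrict_vars (vars_upto N) f = restrict_vars (vars_upto N) g"
  shows "f = g"
proof (rule mfps_eqI)
  fix m :: "indet multiset"
  obtain N where N: "{a. X a \<in># m} \<subseteq> {..N}"
    using finite_X_vimage[of m] finite_nat_set_iff_bounded_le by auto
  have "v \<in> vars_upto N" if "v \<in># m" for v
    using that N by (cases v) (auto simp: vars_upto_def)
  then have "set_mset m \<subseteq> vars_upto N" by auto
  then show "mcoeff f m = mcoeff g m"
    using assms[of N] mcoeff_restrict_vars[of "vars_upto N" _ m] by metis
qed


section \<open>Trees split along the right spine\<close>

text \<open>In \<open>left_wt i j\<close> a left child labeled \<open>i\<close> hangs from a parent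
  labeled \<open>j\<close>; in \<open>right_wt i j\<close> a parent labeled \<open>i\<close> has a
  right child labeled \<open>j\<close>. In both, the first argument is the label that inorder visits
  first.\<close>

definition left_wt :: "nat \<Rightarrow> nat \<Rightarrow> series" where
  "left_wt i j = mvar (if i \<le> j then Lambda_bar else Lambda)"

definition right_wt :: "nat \<Rightarrow> nat \<Rightarrow> series" where
  "right_wt i j = mvar (if i \<le> j then Rho_bar else Rho)"

lemma tree_weight_Leaf [simp]: "tree_weight Leaf = 1"
  by (simp add: tree_weight_def)

lemma tree_weight_Node: "tree_weight (Node l a r) = mvar (X a)
    * (if l = Leaf then 1 else tree_weight l * left_wt (value l) a)
    * (if r = Leaf then 1 else tree_weight r * right_wt a (value r))"
  by (simp add: tree_weight_def left_wt_def right_wt_def power_add mult_ac)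

lemma right_last_inorder_nodes: "T \<noteq> Leaf \<Longrightarrow> right (last (inorder_nodes T)) = Leaf"
proof (induction T)
  case (Node l a r)
  then show ?case by (cases r) auto
qed simp

lemma canopy_Leaf [simp]: "canopy Leaf = []"
  by (simp add: canopy_def)

text \<open>The last node of \<open>l\<close> has no letter in \<open>canopy l\<close>. In the
  larger tree it is no longer last and, having no right child, contributes \<open>U\<close>. The
  root contributes \<open>D\<close> if \<open>r\<close> follows it; otherwise it is the last node
  and has no letter.\<close>

lemma canopy_Node: "canopy (Node l a r) =
    (if l = Leaf then [] else canopy l @ [U]) @ (if r = Leaf then [] else D # canopy r)"
proof -
  have ne: "inorder_nodes T \<noteq> []" if "T \<noteq> Leaf" for T :: "'a tree"
    using that by (cases T) auto
  have "map (\<lambda>v. if right v \<noteq> Leaf then D else U) (inorder_nodes l)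
      = (if l = Leaf then [] else canopy l @ [U])"
  proof (cases "l = Leaf")
    case False
    then obtain vs v where vs: "inorder_nodes l = vs @ [v]"
      using ne by (metis rev_exhaust)
    then show ?thesis
      using False right_last_inorder_nodes[OF False] by (simp add: canopy_def)
  qed simp
  then show ?thesis
    using ne[of r] by (auto simp: canopy_def butlast_append)
qed

section \<open>Grafting and cutting along the right spine\<close>

fun last_label :: "'a tree \<Rightarrow> 'a" where
  "last_label (Node l a r) = (if r = Leaf then a else last_label r)"
| "last_label Leaf = undefined"

text \<open>Grafts \<open>T\<close> as the right child of the last node of the right spine of
  \<open>S\<close>, so that the inorder sequences are concatenated.\<close>

fun join :: "'a tree \<Rightarrow> 'a tree \<Rightarrow> 'a tree" where
  "join Leaf T = T"
| "join (Node l a r) T = Node l a (join r T)"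

lemma join_eq_Leaf [simp]: "join S T = Leaf \<longleftrightarrow> S = Leaf \<and> T = Leaf"
  by (cases S) auto

lemma Leaf_eq_join [simp]: "Leaf = join S T \<longleftrightarrow> S = Leaf \<and> T = Leaf"
  by (cases S) auto

lemma value_join: "S \<noteq> Leaf \<Longrightarrow> value (join S T) = value S"
  by (cases S) auto

lemma last_label_join: "T \<noteq> Leaf \<Longrightarrow> last_label (join S T) = last_label T"
  by (induction S) auto

lemma set_tree_join [simp]: "set_tree (join S T) = set_tree S \<union> set_tree T"
  by (induction S) auto

lemma canopy_join: "S \<noteq> Leaf \<Longrightarrow> T \<noteq> Leaf \<Longrightarrow> canopy (join S T) = canopy S @ D # canopy T"
  by (induction S) (auto simp: canopy_Node)

lemma tree_weight_join: "S \<noteq> Leaf \<Longrightarrow> T \<noteq> Leaf \<Longrightarrow>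
    tree_weight (join S T) = tree_weight S * tree_weight T * right_wt (last_label S) (value T)"
proof (induction S)
  case (Node l a r)
  then show ?case
    by (cases "r = Leaf") (simp_all add: tree_weight_Node value_join mult_ac)
qed simp

text \<open>With \<open>join_last_inject\<close> this makes the removal of the last node and its
  left subtree \<open>l\<close> a bijection; the remainder \<open>S\<close> is \<open>Leaf\<close>
  if that node is the root.\<close>

lemma join_last: "T \<noteq> Leaf \<Longrightarrow> \<exists>S l. T = join S (Node l (last_label T) Leaf)"
proof (induction T)
  case (Node l a r)
  show ?case
  proof (cases "r = Leaf")
    case True
    then show ?thesis by (intro exI[of _ Leaf] exI[of _ l]) simp
  next
    case False
    then obtain S l' where "r = join S (Node l' (last_label r) Leaf)" using Node by blast
    then show ?thesis
      using False by (intro exI[of _ "Node l a S"] exI[of _ l']) simp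
  qed
qed simp

lemma join_last_inject:
  "join S (Node l j Leaf) = join S' (Node l' j' Leaf) \<longleftrightarrow> S = S' \<and> l = l' \<and> j = j'"
proof (induction S arbitrary: S')
  case Leaf
  then show ?case by (cases S') auto
next
  case (Node l a r)
  then show ?case by (cases S') auto
qed

text \<open>One pair for each edge of the right spine; \<open>last_label T1\<close> and
  \<open>value T2\<close> are the labels at the upper and the lower end of that edge.\<close>

definition cuts :: "'a tree \<Rightarrow> ('a tree \<times> 'a tree) set" where
  "cuts T = {(T1, T2). T1 \<noteq> Leaf \<and> T2 \<noteq> Leaf \<and> join T1 T2 = T}"

lemma cuts_Leaf: "cuts Leaf = {}"
  by (auto simp: cuts_def)

lemma cuts_Node: "cuts (Node l a r) =
    (if r = Leaf then {} else insert (Node l a Leaf, r) (apfst (Node l a) ` cuts r))"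
proof (rule set_eqI, clarify)
  fix T1 T2
  show "(T1, T2) \<in> cuts (Node l a r) \<longleftrightarrow> (T1, T2) \<in>
      (if r = Leaf then {} else insert (Node l a Leaf, r) (apfst (Node l a) ` cuts r))"
  proof (cases T1)
    case (Node l' a' r')
    then show ?thesis by (cases "r' = Leaf") (auto simp: cuts_def image_iff)
  qed (auto simp: cuts_def)
qed

lemma finite_cuts: "finite (cuts T)"
  by (induction T) (simp_all add: cuts_Leaf cuts_Node)

text \<open>Consecutive edges of the right spine share a node, so the differences cancel except at
  the root and at the last node.\<close>

lemma cuts_telescope:
  fixes f :: "'a \<Rightarrow> 'b :: ab_group_add"
  shows "T \<noteq> Leaf \<Longrightarrow>
    (\<Sum>(T1, T2) \<in> cuts T. f (last_label T1) - f (value T2)) = f (value T) - f (last_label T)"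
proof (induction T)
  case (Node l a r)
  show ?case
  proof (cases "r = Leaf")
    case False
    have inj: "inj_on (apfst (Node l a)) (cuts r)" by (auto simp: inj_on_def)
    have "(\<Sum>(T1, T2) \<in> cuts (Node l a r). f (last_label T1) - f (value T2)) =
        f a - f (value r) + (\<Sum>(T1, T2) \<in> apfst (Node l a) ` cuts r. f (last_label T1) - f (value T2))"
    proof -
      have "(Node l a Leaf, r) \<notin> apfst (Node l a) ` cuts r"
        by (auto simp: cuts_def)
      then show ?thesis using False by (simp add: cuts_Node finite_cuts)
    qed
    also have "(\<Sum>(T1, T2) \<in> apfst (Node l a) ` cuts r. f (last_label T1) - f (value T2)) =
        (\<Sum>(T1, T2) \<in> cuts r. f (last_label T1) - f (value T2))"
      by (subst sum.reindex[OF inj], rule sum.cong) (auto simp: cuts_def)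
    finally show ?thesis using False Node by simp
  qed (simp add: cuts_Node)
qed simp

section \<open>Recursion for trees on the last letter of the canopy\<close>

definition trees :: "nat \<Rightarrow> letter list \<Rightarrow> nat tree set" where
  "trees N \<nu> = {T. T \<noteq> Leaf \<and> set_tree T \<subseteq> {1..N} \<and> canopy T = \<nu>}"

lemma mem_trees_iff:
  "T \<in> trees N \<nu> \<longleftrightarrow> (T \<noteq> Leaf \<and> set_tree T \<subseteq> {1..N}) \<and> canopy T = \<nu>"
  by (auto simp: trees_def)

text \<open>The canopy thus fixes the number of nodes, which is why \<open>trees\<close> does not
  mention it. \<open>Leaf\<close> is excluded there because its canopy equals that of a single
  node.\<close>

lemma length_canopy: "T \<noteq> Leaf \<Longrightarrow> Suc (length (canopy T)) = size T"
  by (induction T) (auto simp: canopy_Node)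

lemma finite_trees_canopy: "finite (trees N \<nu>)"
proof (rule finite_subset)
  show "trees N \<nu> \<subseteq> {T. size T \<le> Suc (length \<nu>) \<and> set_tree T \<subseteq> {1..N}}"
    by (auto simp: trees_def simp flip: length_canopy)
qed (simp add: finite_trees)

lemma last_label_in_set_tree: "T \<noteq> Leaf \<Longrightarrow> last_label T \<in> set_tree T"
  by (induction T) auto

text \<open>The factorizations of a word at a letter \<open>D\<close>. For trees this letter
  separates the canopy of the upper part from that of the left subtree of the last node; for chains
  it is the opening letter of a last long arc.\<close>

definition splits :: "letter list \<Rightarrow> (letter list \<times> letter list) set" where
  "splits \<mu> = {(\<mu>1, \<mu>2). \<mu>1 @ D # \<mu>2 = \<mu>}"

lemma finite_splits: "finite (splits \<mu>)"
proof (rule finite_subset)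
  show "splits \<mu> \<subseteq> (\<lambda>i. (take i \<mu>, drop (Suc i) \<mu>)) ` {..length \<mu>}"
  proof clarify
    fix \<mu>1 \<mu>2 assume "(\<mu>1, \<mu>2) \<in> splits \<mu>"
    then show "(\<mu>1, \<mu>2) \<in> (\<lambda>i. (take i \<mu>, drop (Suc i) \<mu>)) ` {..length \<mu>}"
      by (intro image_eqI[of _ _ "length \<mu>1"]) (auto simp: splits_def)
  qed
qed simp

text \<open>Stated for arbitrary fibres \<open>A \<nu>\<close> of \<open>wa\<close> and
  \<open>B \<nu>\<close> of \<open>wb\<close>, so that it serves trees with their canopies as well
  as chains with their words.\<close>

lemma sum_over_splits:
  fixes f :: "'a \<Rightarrow> 'b \<Rightarrow> 'c :: comm_monoid_add"
  assumes "\<And>\<nu>. finite (A \<nu>)" "\<And>\<nu>. finite (B \<nu>)"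
    and wa: "\<And>\<nu> a. a \<in> A \<nu> \<longleftrightarrow> P a \<and> wa a = \<nu>" and wb: "\<And>\<nu> b. b \<in> B \<nu> \<longleftrightarrow> Q b \<and> wb b = \<nu>"
  shows "(\<Sum>(\<mu>1, \<mu>2) \<in> splits \<mu>. \<Sum>a \<in> A \<mu>1. \<Sum>b \<in> B \<mu>2. f a b) =
    (\<Sum>(a, b) | P a \<and> Q b \<and> wa a @ D # wb b = \<mu>. f a b)"
proof -
  have "(\<Sum>(\<mu>1, \<mu>2) \<in> splits \<mu>. \<Sum>a \<in> A \<mu>1. \<Sum>b \<in> B \<mu>2. f a b) =
      (\<Sum>m \<in> splits \<mu>. \<Sum>(a, b) \<in> A (fst m) \<times> B (snd m). f a b)"
    by (intro sum.cong) (auto simp: sum.cartesian_product)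
  also have "\<dots> = (\<Sum>(m, a, b) \<in> Sigma (splits \<mu>) (\<lambda>m. A (fst m) \<times> B (snd m)). f a b)"
    by (subst sum.Sigma) (auto simp: assms finite_splits)
  also have "\<dots> = (\<Sum>(a, b) | P a \<and> Q b \<and> wa a @ D # wb b = \<mu>. f a b)"
    by (rule sum.reindex_bij_witness[of _ "\<lambda>(a, b). ((wa a, wb b), a, b)" "\<lambda>(m, a, b). (a, b)"])
       (use wa wb in \<open>auto simp: splits_def\<close>)
  finally show ?thesis .
qed

definition tree_sum :: "nat \<Rightarrow> nat \<Rightarrow> letter list \<Rightarrow> series" where
  "tree_sum N j \<nu> = (\<Sum>T | T \<in> trees N \<nu> \<and> last_label T = j. tree_weight T)"

lemma sum_trees_by_last_label:
  "(\<Sum>T \<in> trees N \<nu>. tree_weight T * g (last_label T)) = (\<Sum>i=1..N. tree_sum N i \<nu> * g i)"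
proof -
  have "last_label ` trees N \<nu> \<subseteq> {1..N}"
    using last_label_in_set_tree by (auto simp: trees_def)
  then have "(\<Sum>i=1..N. \<Sum>T | T \<in> trees N \<nu> \<and> last_label T = i. tree_weight T * g (last_label T))
      = (\<Sum>T \<in> trees N \<nu>. tree_weight T * g (last_label T))"
    by (intro sum.group) (simp_all add: finite_trees_canopy)
  moreover have "(\<Sum>T | T \<in> trees N \<nu> \<and> last_label T = i. tree_weight T * g (last_label T))
      = tree_sum N i \<nu> * g i" for i
    by (simp add: tree_sum_def sum_distrib_right)
  ultimately show ?thesis by simp
qed

lemma tree_sum_Nil:
  assumes "j \<in> {1..N}"
  shows "tree_sum N j [] = mvar (X j)"
proof -
  have "{T. T \<in> trees N [] \<and> last_label T = j} = {Node Leaf j Leaf}"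
  proof (intro equalityI subsetI)
    fix T assume T: "T \<in> {T. T \<in> trees N [] \<and> last_label T = j}"
    then show "T \<in> {Node Leaf j Leaf}"
      by (cases T) (auto simp: trees_def canopy_Node split: if_splits)
  qed (use assms in \<open>auto simp: trees_def canopy_Node\<close>)
  then show ?thesis by (simp add: tree_sum_def tree_weight_Node)
qed

text \<open>The last letter is \<open>D\<close> iff the last node is in the right subtree of its
  inorder predecessor, hence has no left child. Such a tree is a nonempty \<open>S\<close> with one
  leaf attached to its last node.\<close>

lemma tree_sum_snoc_D:
  assumes "j \<in> {1..N}"
  shows "tree_sum N j (\<mu> @ [D]) = mvar (X j) * (\<Sum>i=1..N. tree_sum N i \<mu> * right_wt i j)"
proof -
  let ?e = "Node Leaf j Leaf"
  have "{T. T \<in> trees N (\<mu> @ [D]) \<and> last_label T = j} = (\<lambda>S. join S ?e) ` trees N \<mu>"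
  proof (intro equalityI subsetI)
    fix T assume T: "T \<in> {T. T \<in> trees N (\<mu> @ [D]) \<and> last_label T = j}"
    then obtain S l where S: "T = join S (Node l j Leaf)"
      using join_last by (fastforce simp: trees_def)
    have "S \<noteq> Leaf" "l = Leaf"
      using T by (cases "S = Leaf"; cases "l = Leaf";
          auto simp: S trees_def canopy_Node canopy_join append_eq_Cons_conv)+
    then show "T \<in> (\<lambda>S. join S ?e) ` trees N \<mu>"
      using T by (auto simp: S trees_def canopy_join canopy_Node)
  qed (use assms in \<open>auto simp: trees_def canopy_join canopy_Node last_label_join\<close>)
  moreover have "inj_on (\<lambda>S. join S ?e) (trees N \<mu>)"
    by (auto simp: inj_on_def join_last_inject)
  ultimately have "tree_sum N j (\<mu> @ [D]) = (\<Sum>S \<in> trees N \<mu>. tree_weight (join S ?e))"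
    by (simp add: tree_sum_def sum.reindex)
  also have "\<dots> = mvar (X j) * (\<Sum>S \<in> trees N \<mu>. tree_weight S * right_wt (last_label S) j)"
    unfolding sum_distrib_left
    by (rule sum.cong) (auto simp: trees_def tree_weight_join tree_weight_Node)
  finally show ?thesis
    unfolding sum_trees_by_last_label[where g = "\<lambda>i. right_wt i j"] .
qed

text \<open>\<open>T \<in> trees N (canopy T)\<close> only says that \<open>T\<close> is nonempty
  with labels in \<open>{1..N}\<close>. These pairs have two meanings, and the argument lives on
  their coincidence: they are the cuts of the trees with canopy \<open>\<mu>\<close>
  (\<open>tree_pairs_eq\<close>), and they are the upper part and the left subtree of the last node
  in a tree with canopy \<open>\<mu> @ [U]\<close>.\<close>

definition tree_pairs :: "nat \<Rightarrow> letter list \<Rightarrow> (nat tree \<times> nat tree) set" where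
  "tree_pairs N \<mu> = {(T1, T2). T1 \<in> trees N (canopy T1) \<and> T2 \<in> trees N (canopy T2) \<and>
     canopy T1 @ D # canopy T2 = \<mu>}"

lemma tree_pairs_eq: "tree_pairs N \<mu> = (\<Union>T \<in> trees N \<mu>. cuts T)"
proof (rule set_eqI, clarify)
  fix T1 T2 :: "nat tree"
  have "(T1, T2) \<in> tree_pairs N \<mu> \<longleftrightarrow> (T1, T2) \<in> cuts (join T1 T2) \<and> join T1 T2 \<in> trees N \<mu>"
    by (auto simp: tree_pairs_def trees_def cuts_def canopy_join)
  then show "(T1, T2) \<in> tree_pairs N \<mu> \<longleftrightarrow> (T1, T2) \<in> (\<Union>T \<in> trees N \<mu>. cuts T)"
    by (auto simp: cuts_def)
qed

lemma finite_tree_pairs: "finite (tree_pairs N \<mu>)"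
  by (simp add: tree_pairs_eq finite_trees_canopy finite_cuts)

text \<open>The root label can be replaced by the last label at the cost of a sum over the edges of the
  right spine: by telescoping, only edges \<open>(i, k)\<close> with exactly one end \<open>\<le> j\<close> contribute, and for
  these \<open>right_wt i k = right_wt i j\<close>.\<close>

lemma root_to_last:
  "(\<Sum>T \<in> trees N \<mu>. tree_weight T * left_wt (value T) j)
   + (\<Sum>(T1, T2) \<in> tree_pairs N \<mu>. tree_weight T1 * tree_weight T2
       * (right_wt (last_label T1) j * left_wt (value T2) j)) =
   (\<Sum>T \<in> trees N \<mu>. tree_weight T * left_wt (last_label T) j)
   + (\<Sum>(T1, T2) \<in> tree_pairs N \<mu>. tree_weight T1 * tree_weight T2
       * (right_wt (last_label T1) j * left_wt (last_label T1) j))"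
proof -
  let ?d = "\<lambda>T1 T2. left_wt (last_label T1) j - left_wt (value T2) j"
  \<comment> \<open>If the difference does not vanish, then \<open>i \<le> j < k\<close> or
    \<open>k \<le> j < i\<close>; in either case \<open>i \<le> k\<close> and
    \<open>i \<le> j\<close> have the same truth value.\<close>
  have spine: "right_wt i k * (left_wt i j - left_wt k j) = right_wt i j * (left_wt i j - left_wt k j)"
    for i k
    by (auto simp: left_wt_def right_wt_def)
  have "(\<Sum>T \<in> trees N \<mu>. tree_weight T * (left_wt (value T) j - left_wt (last_label T) j)) =
      (\<Sum>T \<in> trees N \<mu>. \<Sum>(T1, T2) \<in> cuts T. tree_weight T * ?d T1 T2)"
  proof (rule sum.cong)
    fix T assume "T \<in> trees N \<mu>"
    then have "T \<noteq> Leaf" by (simp add: trees_def)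
    from cuts_telescope[OF this, of "\<lambda>i. left_wt i j"]
    show "tree_weight T * (left_wt (value T) j - left_wt (last_label T) j) =
        (\<Sum>(T1, T2) \<in> cuts T. tree_weight T * ?d T1 T2)"
      by (simp add: sum_distrib_left case_prod_unfold flip: sum_distrib_left)
  qed simp
  also have "\<dots> = (\<Sum>T \<in> trees N \<mu>. \<Sum>(T1, T2) \<in> cuts T.
      tree_weight T1 * tree_weight T2 * right_wt (last_label T1) j * ?d T1 T2)"
  proof (intro sum.cong refl, clarify)
    fix T T1 T2 :: "nat tree" assume "(T1, T2) \<in> cuts T"
    then have "tree_weight T * ?d T1 T2 =
        tree_weight T1 * tree_weight T2 * (right_wt (last_label T1) (value T2) * ?d T1 T2)"
      by (auto simp: cuts_def tree_weight_join mult_ac)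
    then show "tree_weight T * ?d T1 T2 =
        tree_weight T1 * tree_weight T2 * right_wt (last_label T1) j * ?d T1 T2"
      unfolding spine by (simp add: mult_ac)
  qed
  also have "\<dots> = (\<Sum>(T1, T2) \<in> tree_pairs N \<mu>.
      tree_weight T1 * tree_weight T2 * right_wt (last_label T1) j * ?d T1 T2)"
    unfolding tree_pairs_eq
    by (subst sum.UNION_disjoint)
       (simp_all add: finite_trees_canopy finite_cuts, auto simp: cuts_def)
  also have "\<dots> = (\<Sum>(T1, T2) \<in> tree_pairs N \<mu>. tree_weight T1 * tree_weight T2
          * (right_wt (last_label T1) j * left_wt (last_label T1) j))
      - (\<Sum>(T1, T2) \<in> tree_pairs N \<mu>. tree_weight T1 * tree_weight T2
          * (right_wt (last_label T1) j * left_wt (value T2) j))"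
    unfolding sum_subtractf[symmetric]
    by (intro sum.cong refl) (auto simp: right_diff_distrib mult.assoc)
  finally show ?thesis
    unfolding right_diff_distrib sum_subtractf by (simp only: eq_diff_eq diff_eq_eq diff_add_eq)
      (simp add: add_ac)
qed

text \<open>Now the last node has a nonempty left subtree \<open>l\<close>, and the part
  \<open>S\<close> above it is either empty (\<open>?A\<close>) or not (\<open>?B\<close>). Both
  sums involve the root label of \<open>l\<close>, which the refinement by last labels cannot see;
  \<open>root_to_last\<close> removes it from both at once.\<close>

lemma tree_sum_snoc_U:
  assumes "j \<in> {1..N}"
  shows "tree_sum N j (\<mu> @ [U]) = mvar (X j) * ((\<Sum>i=1..N. tree_sum N i \<mu> * left_wt i j)
    + (\<Sum>(\<mu>1, \<mu>2) \<in> splits \<mu>. (\<Sum>i=1..N. tree_sum N i \<mu>1 * (right_wt i j * left_wt i j))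
        * (\<Sum>k=1..N. tree_sum N k \<mu>2)))"
proof -
  let ?e = "\<lambda>l. Node l j Leaf"
  let ?A = "?e ` trees N \<mu>" and ?B = "(\<lambda>(S, l). join S (?e l)) ` tree_pairs N \<mu>"
  have "{T. T \<in> trees N (\<mu> @ [U]) \<and> last_label T = j} = ?A \<union> ?B"
  proof (intro equalityI subsetI)
    fix T assume T: "T \<in> {T. T \<in> trees N (\<mu> @ [U]) \<and> last_label T = j}"
    then obtain S l where S: "T = join S (?e l)"
      using join_last by (fastforce simp: trees_def)
    have l: "l \<noteq> Leaf"
      using T by (cases "S = Leaf") (auto simp: S trees_def canopy_Node canopy_join)
    show "T \<in> ?A \<union> ?B"
    proof (cases "S = Leaf")
      case True
      then show ?thesis using T l by (auto simp: S trees_def canopy_Node)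
    next
      case False
      then have "(S, l) \<in> tree_pairs N \<mu>"
        using T l by (auto simp: S trees_def tree_pairs_def canopy_Node canopy_join)
      then show ?thesis using S by (auto simp: image_iff)
    qed
  qed (use assms in \<open>auto simp: trees_def tree_pairs_def canopy_join canopy_Node last_label_join
      simp del: atLeastAtMost_iff\<close>)
  moreover have "?A \<inter> ?B = {}"
  proof -
    have "?e l \<noteq> join S (?e l')" if "S \<noteq> Leaf" for S l l'
      using that by (cases S) auto
    then show ?thesis by (fastforce simp: tree_pairs_def trees_def)
  qed
  ultimately have "tree_sum N j (\<mu> @ [U]) = sum tree_weight ?A + sum tree_weight ?B"
    by (simp add: tree_sum_def sum.union_disjoint finite_trees_canopy finite_tree_pairs)
  also have "sum tree_weight ?A = (\<Sum>l \<in> trees N \<mu>. tree_weight (?e l))"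
    by (subst sum.reindex) (auto simp: inj_on_def)
  also have "\<dots> = mvar (X j) * (\<Sum>l \<in> trees N \<mu>. tree_weight l * left_wt (value l) j)"
    unfolding sum_distrib_left by (rule sum.cong) (auto simp: trees_def tree_weight_Node)
  also have "sum tree_weight ?B = (\<Sum>(S, l) \<in> tree_pairs N \<mu>. tree_weight (join S (?e l)))"
    by (subst sum.reindex) (auto simp: inj_on_def join_last_inject case_prod_unfold prod_eq_iff)
  also have "\<dots> = mvar (X j) * (\<Sum>(S, l) \<in> tree_pairs N \<mu>. tree_weight S * tree_weight l
      * (right_wt (last_label S) j * left_wt (value l) j))"
    unfolding sum_distrib_left
    by (rule sum.cong)
       (auto simp: trees_def tree_pairs_def tree_weight_join tree_weight_Node mult_ac)
  finally have "tree_sum N j (\<mu> @ [U]) = mvar (X j) *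
      ((\<Sum>T \<in> trees N \<mu>. tree_weight T * left_wt (last_label T) j)
       + (\<Sum>(T1, T2) \<in> tree_pairs N \<mu>. tree_weight T1 * tree_weight T2
           * (right_wt (last_label T1) j * left_wt (last_label T1) j)))"
    using root_to_last[where N = N and \<mu> = \<mu> and j = j] by (simp add: distrib_left[symmetric])
  also have "(\<Sum>(T1, T2) \<in> tree_pairs N \<mu>. tree_weight T1 * tree_weight T2
           * (right_wt (last_label T1) j * left_wt (last_label T1) j)) =
     (\<Sum>(\<mu>1, \<mu>2) \<in> splits \<mu>. \<Sum>T1 \<in> trees N \<mu>1. \<Sum>T2 \<in> trees N \<mu>2. tree_weight T1 * tree_weight T2
           * (right_wt (last_label T1) j * left_wt (last_label T1) j))"
    unfolding tree_pairs_def
    by (subst sum_over_splits[where wa = canopy and wb = canopy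
          and P = "\<lambda>T. T \<noteq> Leaf \<and> set_tree T \<subseteq> {1..N}"
          and Q = "\<lambda>T. T \<noteq> Leaf \<and> set_tree T \<subseteq> {1..N}"])
       (auto simp: finite_trees_canopy mem_trees_iff)
  \<comment> \<open>After the exchange the edge weights depend on \<open>T1\<close> alone, so the
    sum over \<open>T2\<close> splits off as a factor.\<close>
  also have "\<dots> = (\<Sum>(\<mu>1, \<mu>2) \<in> splits \<mu>.
      (\<Sum>T1 \<in> trees N \<mu>1. tree_weight T1 * (right_wt (last_label T1) j * left_wt (last_label T1) j))
      * (\<Sum>T2 \<in> trees N \<mu>2. tree_weight T2 * 1))"
    unfolding sum_product by (intro sum.cong refl) (auto simp: mult_ac)
  finally show ?thesis
    unfolding sum_trees_by_last_label[where g = "\<lambda>i. right_wt i j * left_wt i j"]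
      sum_trees_by_last_label[where g = "\<lambda>i. left_wt i j"]
      sum_trees_by_last_label[where g = "\<lambda>i. 1"] by simp
qed

section \<open>Chains of arcs\<close>

text \<open>The list of arcs of a block, each long arc carrying the list of arcs of the block just below
  it. As an interlacing partition has exactly one outermost block below every long arc, such lists
  encode augmented interlacing partitions. The Boolean says whether the left end is marked.\<close>

datatype arc = Short (mark: bool) letter | Long (mark: bool) "arc list"

fun chain_word :: "arc list \<Rightarrow> letter list" where
  "chain_word [] = []"
| "chain_word (Short b c # cs) = c # chain_word cs"
| "chain_word (Long b ds # cs) = D # chain_word ds @ U # chain_word cs"

lemma chain_word_append: "chain_word (cs @ ds) = chain_word cs @ chain_word ds"
  by (induction cs rule: chain_word.induct) auto

definition chains :: "letter list \<Rightarrow> arc list set" where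
  "chains \<nu> = {cs. chain_word cs = \<nu>}"

definition chain_pairs :: "letter list \<Rightarrow> (arc list \<times> arc list) set" where
  "chain_pairs \<mu> = {(cs, ds). chain_word cs @ D # chain_word ds = \<mu>}"

lemma chains_Nil: "chains [] = {[]}"
proof -
  have "chain_word cs = [] \<longleftrightarrow> cs = []" for cs by (cases cs rule: chain_word.cases) auto
  then show ?thesis by (auto simp: chains_def)
qed

lemma chains_snoc_D: "chains (\<mu> @ [D]) = (\<lambda>(cs, b). cs @ [Short b D]) ` (chains \<mu> \<times> UNIV)"
proof (intro equalityI subsetI)
  fix cs assume cs: "cs \<in> chains (\<mu> @ [D])"
  then obtain cs' a where a: "cs = cs' @ [a]"
    by (cases cs rule: rev_cases) (auto simp: chains_def)
  then show "cs \<in> (\<lambda>(cs, b). cs @ [Short b D]) ` (chains \<mu> \<times> UNIV)"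
    using cs by (cases a) (auto simp: chains_def chain_word_append)
qed (auto simp: chains_def chain_word_append)

text \<open>The word of a long arc ends in \<open>U\<close>, so the last arc may be of either kind;
  if it is long, deleting this \<open>U\<close> leaves a word factored at the opening
  \<open>D\<close> of the arc.\<close>

lemma chains_snoc_U: "chains (\<mu> @ [U]) = (\<lambda>(cs, b). cs @ [Short b U]) ` (chains \<mu> \<times> UNIV)
    \<union> (\<lambda>((cs, ds), b). cs @ [Long b ds]) ` (chain_pairs \<mu> \<times> UNIV)"
proof (intro equalityI subsetI)
  fix cs assume cs: "cs \<in> chains (\<mu> @ [U])"
  then obtain cs' a where a: "cs = cs' @ [a]"
    by (cases cs rule: rev_cases) (auto simp: chains_def)
  show "cs \<in> (\<lambda>(cs, b). cs @ [Short b U]) ` (chains \<mu> \<times> UNIV)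
    \<union> (\<lambda>((cs, ds), b). cs @ [Long b ds]) ` (chain_pairs \<mu> \<times> UNIV)"
  proof (cases a)
    case (Long b ds)
    then have "(cs', ds) \<in> chain_pairs \<mu>"
      using cs a by (simp add: chains_def chain_pairs_def chain_word_append)
    then show ?thesis
      using a Long by (intro UnI2 image_eqI[of _ _ "((cs', ds), b)"]) auto
  qed (use cs a in \<open>auto simp: chains_def chain_word_append\<close>)
qed (auto simp: chains_def chain_pairs_def chain_word_append)

lemma chain_pairs_eq: "chain_pairs \<mu> = (\<Union>(\<mu>1, \<mu>2) \<in> splits \<mu>. chains \<mu>1 \<times> chains \<mu>2)"
  by (auto simp: chain_pairs_def splits_def chains_def)

lemma finite_chains: "finite (chains \<nu>)"
proof (induction \<nu> rule: length_induct)
  case (1 \<nu>)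
  show ?case
  proof (cases \<nu> rule: rev_cases)
    case (snoc \<mu> c)
    have \<mu>: "finite (chains \<mu>)" using 1 snoc by simp
    have "finite (chains \<mu>1 \<times> chains \<mu>2)" if "(\<mu>1, \<mu>2) \<in> splits \<mu>" for \<mu>1 \<mu>2
      using that 1 snoc by (auto simp: splits_def)
    then have "finite (chain_pairs \<mu>)"
      unfolding chain_pairs_eq by (intro finite_UN_I finite_splits) auto
    with \<mu> show ?thesis
      using snoc by (cases c) (auto simp: chains_snoc_D chains_snoc_U)
  qed (simp add: chains_Nil)
qed

lemma finite_chain_pairs: "finite (chain_pairs \<mu>)"
  unfolding chain_pairs_eq using finite_splits finite_chains by auto

section \<open>Truncated ribbon Schur functions, refined by the last letter\<close>

definition pattern_words :: "nat \<Rightarrow> bool list \<Rightarrow> nat list set" where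
  "pattern_words N bs = {w. length w = Suc (length bs) \<and> set w \<subseteq> {1..N} \<and>
     (\<forall>i < length bs. bs ! i \<longleftrightarrow> w ! Suc i < w ! i)}"

text \<open>Entry \<open>True\<close> in \<open>bs\<close> prescribes a descent and
  \<open>False\<close> a weak ascent. Fixing the last letter makes the effect of one more entry
  computable; the unrefined \<open>ribbon_upto\<close> is the truncation of a ribbon Schur function
  (\<open>restrict_vars_ribbon\<close>).\<close>

definition ribbon_last :: "nat \<Rightarrow> bool list \<Rightarrow> nat \<Rightarrow> series" where
  "ribbon_last N bs j = (\<Sum>w | w \<in> pattern_words N bs \<and> last w = j. \<Prod>a\<leftarrow>w. mvar (X a))"

definition ribbon_upto :: "nat \<Rightarrow> bool list \<Rightarrow> series" where
  "ribbon_upto N bs = (\<Sum>w \<in> pattern_words N bs. \<Prod>a\<leftarrow>w. mvar (X a))"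

lemma finite_pattern_words: "finite (pattern_words N bs)"
  by (rule finite_subset[of _ "{w. set w \<subseteq> {1..N} \<and> length w = Suc (length bs)}"])
     (auto simp: pattern_words_def finite_lists_length_eq)

lemma ribbon_upto_eq_sum_last: "ribbon_upto N bs = (\<Sum>j=1..N. ribbon_last N bs j)"
proof -
  have "last ` pattern_words N bs \<subseteq> {1..N}"
    by (auto simp: pattern_words_def simp del: atLeastAtMost_iff intro!: subsetD[OF _ last_in_set])
  then show ?thesis
    unfolding ribbon_upto_def ribbon_last_def
    by (intro sum.group[symmetric]) (simp_all add: finite_pattern_words)
qed

lemma ribbon_last_Nil: "j \<in> {1..N} \<Longrightarrow> ribbon_last N [] j = mvar (X j)"
proof -
  assume j: "j \<in> {1..N}"
  have "{w. w \<in> pattern_words N [] \<and> last w = j} = {[j]}"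
    using j by (auto simp: pattern_words_def length_Suc_conv)
  then show ?thesis by (simp add: ribbon_last_def)
qed

lemma pattern_words_snoc: "w @ [j] \<in> pattern_words N (bs @ [b]) \<longleftrightarrow>
    w \<in> pattern_words N bs \<and> j \<in> {1..N} \<and> (b \<longleftrightarrow> j < last w)"
proof (cases "length w = Suc (length bs)")
  case True
  have "w \<noteq> []" "length w - Suc 0 = length bs" using True by auto
  then have "last w = w ! length bs" by (simp add: last_conv_nth)
  then show ?thesis
    using True by (auto simp: pattern_words_def nth_append All_less_Suc)
qed (auto simp: pattern_words_def)

lemma ribbon_last_snoc:
  assumes "j \<in> {1..N}"
  shows "ribbon_last N (bs @ [b]) j =
    mvar (X j) * (\<Sum>i=1..N. if b \<longleftrightarrow> j < i then ribbon_last N bs i else 0)"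
proof -
  have "{w \<in> pattern_words N (bs @ [b]). last w = j} =
      (\<lambda>w. w @ [j]) ` {w \<in> pattern_words N bs. b \<longleftrightarrow> j < last w}"
  proof (intro equalityI subsetI)
    fix w assume w: "w \<in> {w \<in> pattern_words N (bs @ [b]). last w = j}"
    then have "w = butlast w @ [j]"
      by (auto simp: pattern_words_def intro!: append_butlast_last_id[symmetric])
    then show "w \<in> (\<lambda>w. w @ [j]) ` {w \<in> pattern_words N bs. b \<longleftrightarrow> j < last w}"
      using w pattern_words_snoc[of "butlast w" j N bs b] by force
  qed (use assms in \<open>auto simp: pattern_words_snoc\<close>)
  then have "ribbon_last N (bs @ [b]) j =
      (\<Sum>w | w \<in> pattern_words N bs \<and> (b \<longleftrightarrow> j < last w). mvar (X j) * (\<Prod>a\<leftarrow>w. mvar (X a)))"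
    unfolding ribbon_last_def by (simp add: sum.reindex inj_on_def mult.commute)
  also have "\<dots> = mvar (X j) * (\<Sum>w \<in> pattern_words N bs.
      if b \<longleftrightarrow> j < last w then \<Prod>a\<leftarrow>w. mvar (X a) else 0)"
    by (simp add: sum_distrib_left finite_pattern_words flip: sum.inter_filter)
  also have "(\<Sum>w \<in> pattern_words N bs. if b \<longleftrightarrow> j < last w then \<Prod>a\<leftarrow>w. mvar (X a) else 0) =
      (\<Sum>i=1..N. \<Sum>w | w \<in> pattern_words N bs \<and> last w = i.
        if b \<longleftrightarrow> j < last w then \<Prod>a\<leftarrow>w. mvar (X a) else 0)"
    by (intro sum.group[symmetric])
       (simp_all only: finite_pattern_words finite_atLeastAtMost,
        auto simp: pattern_words_def simp del: atLeastAtMost_iff intro!: subsetD[OF _ last_in_set])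
  also have "\<dots> = (\<Sum>i=1..N. if b \<longleftrightarrow> j < i then ribbon_last N bs i else 0)"
    unfolding ribbon_last_def by (intro sum.cong) auto
  finally show ?thesis .
qed

text \<open>\<open>b\<close> tells whether the left end of the arc is marked. Marks become descents
  of ribbon words, so for \<open>b = (j < i)\<close> these are the two edge weights of
  trees.\<close>

fun short_wt :: "bool \<Rightarrow> letter \<Rightarrow> series" where
  "short_wt b U = mvar (if b then Lambda else Lambda_bar)"
| "short_wt b D = mvar (if b then Rho else Rho_bar)"

lemma left_wt_eq_short_wt: "left_wt i j = short_wt (j < i) U"
  and right_wt_eq_short_wt: "right_wt i j = short_wt (j < i) D"
  by (auto simp: left_wt_def right_wt_def)

text \<open>For each letter \<open>i\<close> before the final \<open>j\<close>, exactly one of the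
  two marks is compatible with the step from \<open>i\<close> to \<open>j\<close>, namely
  \<open>j < i\<close>. Summing over the mark therefore turns a weight of the mark into a weight of
  the pair \<open>i\<close>, \<open>j\<close>. This is where marked arcs acquire tree-like
  weights.\<close>

lemma sum_mark_ribbon_last:
  assumes "j \<in> {1..N}"
  shows "(\<Sum>b\<in>UNIV. g b * ribbon_last N (bs @ [b]) j) =
    mvar (X j) * (\<Sum>i=1..N. ribbon_last N bs i * g (j < i))"
proof -
  have "(\<Sum>b\<in>UNIV. g b * ribbon_last N (bs @ [b]) j) = mvar (X j) * (\<Sum>i=1..N.
      g False * (if False \<longleftrightarrow> j < i then ribbon_last N bs i else 0)
      + g True * (if True \<longleftrightarrow> j < i then ribbon_last N bs i else 0))"
    unfolding UNIV_bool sum.distrib sum_distrib_left[symmetric] ribbon_last_snoc[OF assms]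
    by (simp add: algebra_simps)
  also have "\<dots> = mvar (X j) * (\<Sum>i=1..N. ribbon_last N bs i * g (j < i))"
    by (intro arg_cong2[of _ _ _ _ times] sum.cong) auto
  finally show ?thesis .
qed

text \<open>The ribbon of the block carrying the list itself is left out and multiplied in later, as
  \<open>ribbon_last\<close> in the recursion or as \<open>ribbon_upto\<close> in the total. A block
  below a long arc enters with its full ribbon.\<close>

fun arcs_wt :: "nat \<Rightarrow> arc list \<Rightarrow> series" where
  "arcs_wt N [] = 1"
| "arcs_wt N (Short b c # cs) = short_wt b c * arcs_wt N cs"
| "arcs_wt N (Long b ds # cs) =
     short_wt b D * short_wt b U * (arcs_wt N ds * ribbon_upto N (map mark ds)) * arcs_wt N cs"

lemma arcs_wt_append: "arcs_wt N (cs @ ds) = arcs_wt N cs * arcs_wt N ds"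
  by (induction N cs rule: arcs_wt.induct) (simp_all add: mult_ac)

definition chain_sum :: "nat \<Rightarrow> nat \<Rightarrow> letter list \<Rightarrow> series" where
  "chain_sum N j \<nu> = (\<Sum>cs \<in> chains \<nu>. arcs_wt N cs * ribbon_last N (map mark cs) j)"

lemma sum_chains_ribbon_last:
  "(\<Sum>cs \<in> chains \<nu>. arcs_wt N cs * (\<Sum>i=1..N. ribbon_last N (map mark cs) i * g i)) =
    (\<Sum>i=1..N. chain_sum N i \<nu> * g i)"
  unfolding chain_sum_def sum_distrib_left sum_distrib_right
  by (subst sum.swap) (simp add: mult.assoc)

lemma sum_chains_ribbon_upto:
  "(\<Sum>cs \<in> chains \<nu>. arcs_wt N cs * ribbon_upto N (map mark cs)) = (\<Sum>i=1..N. chain_sum N i \<nu>)"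
  using sum_chains_ribbon_last[where g = "\<lambda>_. 1"] by (simp add: ribbon_upto_eq_sum_last)

lemma chain_sum_Nil: "j \<in> {1..N} \<Longrightarrow> chain_sum N j [] = mvar (X j)"
  by (simp add: chain_sum_def chains_Nil ribbon_last_Nil)

lemma sum_chains_Short:
  assumes "j \<in> {1..N}"
  shows "(\<Sum>(cs, b) \<in> chains \<mu> \<times> UNIV.
      arcs_wt N (cs @ [Short b c]) * ribbon_last N (map mark (cs @ [Short b c])) j) =
    mvar (X j) * (\<Sum>i=1..N. chain_sum N i \<mu> * short_wt (j < i) c)"
proof -
  have "(\<Sum>(cs, b) \<in> chains \<mu> \<times> UNIV.
      arcs_wt N (cs @ [Short b c]) * ribbon_last N (map mark (cs @ [Short b c])) j) =
    (\<Sum>cs \<in> chains \<mu>. arcs_wt N cs *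
      (\<Sum>b\<in>UNIV. short_wt b c * ribbon_last N (map mark cs @ [b]) j))"
    by (simp add: arcs_wt_append sum_distrib_left mult.assoc del: sum.cartesian_product
        UNIV_bool flip: sum.cartesian_product)
  also have "\<dots> = mvar (X j) * (\<Sum>cs \<in> chains \<mu>. arcs_wt N cs *
      (\<Sum>i=1..N. ribbon_last N (map mark cs) i * short_wt (j < i) c))"
    unfolding sum_mark_ribbon_last[OF assms, of "\<lambda>b. short_wt b c"]
    by (simp add: sum_distrib_left mult.left_commute)
  finally show ?thesis
    unfolding sum_chains_ribbon_last[where g = "\<lambda>i. short_wt (j < i) c"] .
qed

lemma chain_sum_snoc_D:
  assumes "j \<in> {1..N}"
  shows "chain_sum N j (\<mu> @ [D]) = mvar (X j) * (\<Sum>i=1..N. chain_sum N i \<mu> * right_wt i j)"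
proof -
  have inj: "inj_on (\<lambda>(cs, b). cs @ [Short b D]) (chains \<mu> \<times> UNIV)"
    by (auto simp: inj_on_def)
  show ?thesis
    unfolding right_wt_eq_short_wt sum_chains_Short[OF assms, symmetric]
    unfolding chain_sum_def chains_snoc_D sum.reindex[OF inj]
    by (intro sum.cong) auto
qed

text \<open>A last long arc has one mark, hence both its weights refer to the same pair
  \<open>i\<close>, \<open>j\<close>, while the chain below it enters only through its total sum.
  This is the form to which \<open>root_to_last\<close> brings the trees.\<close>

lemma chain_sum_snoc_U:
  assumes "j \<in> {1..N}"
  shows "chain_sum N j (\<mu> @ [U]) = mvar (X j) * ((\<Sum>i=1..N. chain_sum N i \<mu> * left_wt i j)
    + (\<Sum>(\<mu>1, \<mu>2) \<in> splits \<mu>. (\<Sum>i=1..N. chain_sum N i \<mu>1 * (right_wt i j * left_wt i j))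
        * (\<Sum>k=1..N. chain_sum N k \<mu>2)))"
proof -
  let ?f = "\<lambda>cs. arcs_wt N cs * ribbon_last N (map mark cs) j"
  let ?S = "(\<lambda>(cs, b). cs @ [Short b U]) ` (chains \<mu> \<times> UNIV)"
    and ?L = "(\<lambda>((cs, ds), b). cs @ [Long b ds]) ` (chain_pairs \<mu> \<times> UNIV)"
  have "chain_sum N j (\<mu> @ [U]) = sum ?f ?S + sum ?f ?L"
    unfolding chain_sum_def chains_snoc_U
    by (intro sum.union_disjoint) (auto simp: finite_chains finite_chain_pairs)
  also have "sum ?f ?S = (\<Sum>(cs, b) \<in> chains \<mu> \<times> UNIV. ?f (cs @ [Short b U]))"
    by (subst sum.reindex) (auto simp: inj_on_def case_prod_unfold)
  also have "sum ?f ?L = (\<Sum>((cs, ds), b) \<in> chain_pairs \<mu> \<times> UNIV. ?f (cs @ [Long b ds]))"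
    by (subst sum.reindex) (auto simp: inj_on_def case_prod_unfold)
  also have "\<dots> = (\<Sum>(cs, ds) \<in> chain_pairs \<mu>. arcs_wt N cs * (arcs_wt N ds * ribbon_upto N (map mark ds))
      * (\<Sum>b\<in>UNIV. short_wt b D * short_wt b U * ribbon_last N (map mark cs @ [b]) j))"
    unfolding sum.cartesian_product'
    by (simp add: arcs_wt_append sum_distrib_left mult_ac case_prod_unfold
        del: UNIV_bool short_wt.simps)
  also have "\<dots> = mvar (X j) * (\<Sum>(cs, ds) \<in> chain_pairs \<mu>.
      arcs_wt N cs * (\<Sum>i=1..N. ribbon_last N (map mark cs) i * (right_wt i j * left_wt i j))
      * (arcs_wt N ds * ribbon_upto N (map mark ds)))"
    unfolding sum_mark_ribbon_last[OF assms, of "\<lambda>b. short_wt b D * short_wt b U"]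
      left_wt_eq_short_wt right_wt_eq_short_wt
    by (simp add: sum_distrib_left case_prod_unfold mult_ac)
  also have "(\<Sum>(cs, ds) \<in> chain_pairs \<mu>.
      arcs_wt N cs * (\<Sum>i=1..N. ribbon_last N (map mark cs) i * (right_wt i j * left_wt i j))
      * (arcs_wt N ds * ribbon_upto N (map mark ds))) =
    (\<Sum>(\<mu>1, \<mu>2) \<in> splits \<mu>. \<Sum>cs \<in> chains \<mu>1. \<Sum>ds \<in> chains \<mu>2.
      arcs_wt N cs * (\<Sum>i=1..N. ribbon_last N (map mark cs) i * (right_wt i j * left_wt i j))
      * (arcs_wt N ds * ribbon_upto N (map mark ds)))"
    unfolding chain_pairs_def
    by (subst sum_over_splits[where wa = chain_word and wb = chain_word
          and P = "\<lambda>_. True" and Q = "\<lambda>_. True"])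
       (auto simp: finite_chains chains_def[symmetric], simp_all add: chains_def)
  also have "\<dots> = (\<Sum>(\<mu>1, \<mu>2) \<in> splits \<mu>. (\<Sum>i=1..N. chain_sum N i \<mu>1 * (right_wt i j * left_wt i j))
        * (\<Sum>k=1..N. chain_sum N k \<mu>2))"
    unfolding sum_chains_ribbon_last[symmetric] sum_chains_ribbon_upto[symmetric] sum_product ..
  finally show ?thesis
    by (simp only: sum_chains_Short[OF assms] left_wt_eq_short_wt distrib_left)
qed

section \<open>Agreement of the tree and the chain recursion\<close>

lemma tree_sum_eq_chain_sum: "j \<in> {1..N} \<Longrightarrow> tree_sum N j \<nu> = chain_sum N j \<nu>"
proof (induction \<nu> arbitrary: j rule: length_induct)
  case (1 \<nu>)
  show ?case
  proof (cases \<nu> rule: rev_cases)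
    case Nil
    then show ?thesis using 1 by (simp only: tree_sum_Nil chain_sum_Nil)
  next
    case (snoc \<mu> c)
    then have IH: "tree_sum N i \<mu>' = chain_sum N i \<mu>'" if "i \<in> {1..N}" "length \<mu>' \<le> length \<mu>" for i \<mu>'
      using 1 that by simp
    then have split: "(\<Sum>i=1..N. tree_sum N i \<mu>1 * (right_wt i j * left_wt i j)) * (\<Sum>k=1..N. tree_sum N k \<mu>2) =
        (\<Sum>i=1..N. chain_sum N i \<mu>1 * (right_wt i j * left_wt i j)) * (\<Sum>k=1..N. chain_sum N k \<mu>2)"
      if "(\<mu>1, \<mu>2) \<in> splits \<mu>" for \<mu>1 \<mu>2
      using that by (auto simp: splits_def)
    show ?thesis
    proof (cases c)
      case U
      have "(\<Sum>(\<mu>1, \<mu>2) \<in> splits \<mu>. (\<Sum>i=1..N. tree_sum N i \<mu>1 * (right_wt i j * left_wt i j)) * (\<Sum>k=1..N. tree_sum N k \<mu>2)) =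
        (\<Sum>(\<mu>1, \<mu>2) \<in> splits \<mu>. (\<Sum>i=1..N. chain_sum N i \<mu>1 * (right_wt i j * left_wt i j)) * (\<Sum>k=1..N. chain_sum N k \<mu>2))"
        using split by (intro sum.cong) auto
      then show ?thesis
        using 1 U snoc IH by (simp add: tree_sum_snoc_U chain_sum_snoc_U)
    next
      case D
      then show ?thesis using 1 snoc IH by (simp add: tree_sum_snoc_D chain_sum_snoc_D)
    qed
  qed
qed

lemma sum_trees_eq_sum_chains:
  "(\<Sum>T \<in> trees N \<nu>. tree_weight T) = (\<Sum>cs \<in> chains \<nu>. arcs_wt N cs * ribbon_upto N (map mark cs))"
proof -
  have "(\<Sum>T \<in> trees N \<nu>. tree_weight T) = (\<Sum>i=1..N. tree_sum N i \<nu>)"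
    using sum_trees_by_last_label[where g = "\<lambda>_. 1"] by simp
  also have "\<dots> = (\<Sum>i=1..N. chain_sum N i \<nu>)"
    by (intro sum.cong tree_sum_eq_chain_sum) auto
  also have "\<dots> = (\<Sum>cs \<in> chains \<nu>. arcs_wt N cs * ribbon_upto N (map mark cs))"
    by (rule sum_chains_ribbon_upto[symmetric])
  finally show ?thesis .
qed

section \<open>Gluing a point and an interlacing partition in front\<close>

text \<open>Arbitrary intervals avoid renumbering the parts below and behind an arc. Half-open ones
  include the empty partition of \<open>{k..<k}\<close>, which is what lies below a short
  arc.\<close>

definition interlacing_on :: "nat \<Rightarrow> nat \<Rightarrow> nat set set \<Rightarrow> bool" where
  "interlacing_on k e F \<longleftrightarrow> partition_on {k..<e} F \<and> noncrossing F \<and> interlacing F"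

lemma interlacing_onD:
  assumes "interlacing_on k e F" "A \<in> F"
  shows "A \<subseteq> {k..<e}" "A \<noteq> {}" "finite A"
proof -
  show "A \<subseteq> {k..<e}" "A \<noteq> {}"
    using assms by (auto simp: interlacing_on_def partition_on_def)
  then show "finite A" using finite_subset by blast
qed

lemma interlacing_on_disjoint:
  "interlacing_on k e F \<Longrightarrow> A \<in> F \<Longrightarrow> B \<in> F \<Longrightarrow> x \<in> A \<Longrightarrow> x \<in> B \<Longrightarrow> A = B"
  by (auto simp: interlacing_on_def partition_on_def disjoint_def)

lemma interlacing_on_crossing:
  assumes "interlacing_on k e F" "A \<in> F" "B \<in> F" "a < b" "b < c" "c < d"
    "a \<in> A" "c \<in> A" "b \<in> B" "d \<in> B"
  shows "A = B"
proof (rule ccontr)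
  assume "A \<noteq> B"
  moreover have "\<exists>a b c d. a < b \<and> b < c \<and> c < d \<and> a \<in> A \<and> c \<in> A \<and> b \<in> B \<and> d \<in> B"
    using assms(4-10) by (intro exI[of _ a] exI[of _ b] exI[of _ c] exI[of _ d]) simp
  ultimately have "\<not> noncrossing F" using assms(2,3) unfolding noncrossing_def by metis
  then show False using assms(1) by (simp add: interlacing_on_def)
qed

lemma interlacing_on_empty: "interlacing_on k k {}"
  by (simp add: interlacing_on_def partition_on_def noncrossing_def interlacing_def)

lemma interlacing_on_singleton: "interlacing_on k (Suc k) {{k}}"
  by (auto simp: interlacing_on_def partition_on_def noncrossing_def interlacing_def)

lemma Max_insert_less: "finite S \<Longrightarrow> j \<in> S \<Longrightarrow> k < j \<Longrightarrow> Max (insert k S) = Max S" for k j :: nat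
  by (subst Max_insert) (auto simp: max_def dest: Max_ge)

text \<open>The new point \<open>k\<close> joins the block of \<open>j\<close>, and \<open>Q\<close>
  fills the gap between them. The interlacing condition survives at both seams: \<open>k\<close> is
  not a maximum, since \<open>S\<close> follows in its block, and \<open>j\<close> is no longer a
  minimum, since \<open>k\<close> precedes it. So \<open>Q\<close> may start right after
  \<open>k\<close> and end right before \<open>j\<close>.\<close>

lemma interlacing_on_glue:
  assumes Q: "interlacing_on (Suc k) j Q" and F: "interlacing_on j e (insert S I)"
    and "k < j" "j \<in> S" "S \<notin> I"
  shows "interlacing_on k e (Q \<union> insert (insert k S) I)"
proof -
  have rQ: "A \<subseteq> {Suc k..<j}" "A \<noteq> {}" "finite A" if "A \<in> Q" for A
    using interlacing_onD[OF Q that] by auto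
  have rF: "A \<subseteq> {j..<e}" "A \<noteq> {}" "finite A" if "A \<in> insert S I" for A
    using interlacing_onD[OF F that] by auto
  have S: "S \<subseteq> {j..<e}" "finite S" using rF by auto
  have jI: "j \<notin> A" if "A \<in> I" for A
    using that \<open>j \<in> S\<close> \<open>S \<notin> I\<close> interlacing_on_disjoint[OF F, of A S j] by auto
  have UQ: "\<Union>Q = {Suc k..<j}" and UF: "\<Union>(insert S I) = {j..<e}"
    using Q F by (simp_all add: interlacing_on_def partition_on_def)
  have "j < e" using S \<open>j \<in> S\<close> by auto
  have "partition_on {k..<e} (Q \<union> insert (insert k S) I)"
  proof (rule partition_onI)
    have "\<Union>(Q \<union> insert (insert k S) I) = insert k (\<Union>Q \<union> \<Union>(insert S I))" by auto
    also have "\<dots> = {k..<e}" unfolding UQ UF using \<open>k < j\<close> \<open>j < e\<close> by auto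
    finally show "\<Union>(Q \<union> insert (insert k S) I) = {k..<e}" .
  next
    fix A B assume AB: "A \<in> Q \<union> insert (insert k S) I" "B \<in> Q \<union> insert (insert k S) I" "A \<noteq> B"
    show "disjnt A B"
      unfolding disjnt_iff
    proof (intro allI notI)
      fix x assume x: "x \<in> A \<and> x \<in> B"
      consider "A \<in> Q" "B \<in> Q" | "A \<in> Q" "B \<notin> Q" | "A \<notin> Q" "B \<in> Q" | "A \<notin> Q" "B \<notin> Q" by blast
      then show False
      proof cases
        case 1
        then show ?thesis using AB(3) x interlacing_on_disjoint[OF Q] by blast
      next
        case 2
        then have "x \<in> insert k {j..<e}" "x \<in> {Suc k..<j}" using AB x rF(1) rQ(1) by blast+
        then show ?thesis by auto
      next
        case 3
        then have "x \<in> insert k {j..<e}" "x \<in> {Suc k..<j}" using AB x rF(1) rQ(1) by blast+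
        then show ?thesis by auto
      next
        case 4
        then have A: "A = insert k S \<or> A \<in> I" and B: "B = insert k S \<or> B \<in> I"
          using AB by auto
        have kI: "k \<notin> C" if "C \<in> I" for C
          using rF(1)[of C] that \<open>k < j\<close> by auto
        show ?thesis
        proof (cases "x = k")
          case True
          then show ?thesis using A B kI x AB(3) by blast
        next
          case False
          have "S = B" if "A = insert k S" "B \<in> I"
            using that x False by (intro interlacing_on_disjoint[OF F, of S B x]) auto
          moreover have "A = S" if "B = insert k S" "A \<in> I"
            using that x False by (intro interlacing_on_disjoint[OF F, of A S x]) auto
          moreover have "A = B" if "A \<in> I" "B \<in> I"
            using that x by (intro interlacing_on_disjoint[OF F, of A B x]) auto
          ultimately show ?thesis using A B AB(3) \<open>S \<notin> I\<close> by blast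
        qed
      qed
    qed
  qed (use rQ(2) rF(2)[of "{}"] in auto)
  moreover have "noncrossing (Q \<union> insert (insert k S) I)"
    unfolding noncrossing_def
  proof (clarify)
    fix A B a b c d
    assume AB: "A \<in> Q \<union> insert (insert k S) I" "B \<in> Q \<union> insert (insert k S) I" "A \<noteq> B"
      and lt: "a < b" "b < c" "c < d" and mem: "a \<in> A" "c \<in> A" "b \<in> B" "d \<in> B"
    have ncQ: False if "A \<in> Q" "B \<in> Q"
      using interlacing_on_crossing[OF Q that lt mem] AB(3) by simp
    have ncF: False if "A' \<in> insert S I" "B' \<in> insert S I" "A' \<noteq> B'" "a' < b"
        "a' \<in> A'" "c \<in> A'" "b \<in> B'" "d \<in> B'" for A' B' a'
      using interlacing_on_crossing[OF F that(1,2,4) lt(2,3) that(5-8)] that(3) by simp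
    consider "A \<in> Q" "B \<in> Q" | "A \<in> Q" "B \<notin> Q" | "A \<notin> Q" "B \<in> Q" | "A \<notin> Q" "B \<notin> Q" by blast
    then show False
    proof cases
      case 2
      then have "b \<in> insert k {j..<e}" using AB mem rF(1) by blast
      moreover have "a \<in> {Suc k..<j}" "c \<in> {Suc k..<j}" using 2 rQ(1) mem by blast+
      ultimately show ?thesis using lt by auto
    next
      case 3
      then have "c \<in> insert k {j..<e}" using AB mem rF(1) by blast
      moreover have "b \<in> {Suc k..<j}" "d \<in> {Suc k..<j}" using 3 rQ(1) mem by blast+
      ultimately show ?thesis using lt by auto
    next
      case 4
      then have A: "A \<in> insert (insert k S) I" and B: "B \<in> insert (insert k S) I"
        using AB by auto
      show ?thesis
      proof (cases "B = insert k S")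
        case True
        then have "A \<in> I" using A AB by auto
        then have "a \<ge> j" using rF(1)[of A] mem by auto
        then have "b \<in> S" "d \<in> S" using True mem lt \<open>k < j\<close> by auto
        then show False using ncF[of A S a] \<open>A \<in> I\<close> \<open>S \<notin> I\<close> mem lt by auto
      next
        case False
        then have "B \<in> I" using B by auto
        then have "b > j" using rF(1)[of B] mem jI[of B] by (cases "b = j") fastforce+
        show False
        proof (cases "A = insert k S")
          case True
          then have "c \<in> S" using mem lt \<open>b > j\<close> \<open>k < j\<close> by auto
          \<comment> \<open>\<open>j\<close> takes the place of \<open>a\<close>, which may be the
            new point \<open>k\<close>: since \<open>j < b\<close>, the crossing is already one
            between \<open>S\<close> and \<open>B\<close>.\<close>
          then show False
            using ncF[of S B j] \<open>B \<in> I\<close> \<open>S \<notin> I\<close> mem \<open>b > j\<close> \<open>j \<in> S\<close> by auto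
        next
          case False
          then show False using ncF[of A B a] A \<open>B \<in> I\<close> mem lt AB by auto
        qed
      qed
    qed (rule ncQ)
  qed
  moreover have "interlacing (Q \<union> insert (insert k S) I)"
    unfolding interlacing_def
  proof (clarify)
    fix A B assume A: "A \<in> Q \<union> insert (insert k S) I" and B: "B \<in> Q \<union> insert (insert k S) I"
      and eq: "Max A + 1 = Min B"
    have iQ: False if "A \<in> Q" "B \<in> Q"
      using that eq Q unfolding interlacing_on_def interlacing_def by force
    have iF: False if "A' \<in> insert S I" "B \<in> insert S I" "Max A' = Max A" for A'
      using that eq F unfolding interlacing_on_def interlacing_def by force
    have mM: "Max A \<in> A" "Min B \<in> B" using A B rQ rF S by auto
    have "B \<noteq> insert k S"
    proof
      assume "B = insert k S"
      then have "Min B \<le> k" using S by simp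
      moreover have "Max A \<ge> k" using A mM(1) rQ(1) rF(1) S \<open>k < j\<close> by fastforce
      ultimately show False using eq by simp
    qed
    then consider "B \<in> Q" | "B \<in> I" "A \<in> Q" | "B \<in> I" "A \<in> insert (insert k S) I"
      using A B by auto
    then show False
    proof cases
      case 1
      have "A \<in> Q"
      proof (rule ccontr)
        assume "A \<notin> Q"
        have "Max A \<ge> j"
        proof (cases "A = insert k S")
          case True
          then show ?thesis using S(2) \<open>j \<in> S\<close> by simp
        next
          case False
          then show ?thesis using A \<open>A \<notin> Q\<close> rF(1)[of A] mM(1) by auto
        qed
        then show False using eq 1 rQ(1)[of B] mM by auto
      qed
      then show False using iQ 1 by simp
    next
      case 2
      then have "Max A < j" "Min B \<ge> j" using mM rQ(1)[of A] rF(1)[of B] by auto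
      then have "Min B = j" using eq by simp
      then show False using jI 2 mM by metis
    next
      case 3
      then show False
        using iF[of S] iF[of A] Max_insert_less[OF S(2) \<open>j \<in> S\<close> \<open>k < j\<close>] by auto
    qed
  qed
  ultimately show ?thesis by (simp add: interlacing_on_def)
qed

lemma arcs_Un: "arcs (F \<union> G) = arcs F \<union> arcs G"
  by (auto simp: arcs_def)

lemma arcs_insert_less:
  assumes "k < j" "j \<in> S" "\<And>x. x \<in> S \<Longrightarrow> j \<le> x"
  shows "arcs {insert k S} = insert (k, j) (arcs {S})"
proof (rule set_eqI, clarify)
  fix a b
  have "k \<notin> S" using assms(1,3) by force
  then show "(a, b) \<in> arcs {insert k S} \<longleftrightarrow> (a, b) \<in> insert (k, j) (arcs {S})"
    using assms by (auto simp: arcs_def) (force dest: le_neq_implies_less)+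
qed

lemma arcs_glue:
  assumes "k < j" "j \<in> S" "\<And>x. x \<in> S \<Longrightarrow> j \<le> x"
  shows "arcs (Q \<union> insert (insert k S) I) = insert (k, j) (arcs Q \<union> arcs (insert S I))"
  using arcs_insert_less[OF assms] arcs_Un[of Q "insert (insert k S) I"]
    arcs_Un[of "{insert k S}" I] arcs_Un[of "{S}" I] by auto

lemma arcs_range: "interlacing_on k e F \<Longrightarrow> (i, j) \<in> arcs F \<Longrightarrow> k \<le> i \<and> i < j \<and> j < e"
  using interlacing_onD(1) by (fastforce simp: arcs_def)


section \<open>Decoding chains\<close>

text \<open>A list without arcs is a single point. Hence the region below a long arc is never empty,
  and such an arc has length at least 2.\<close>

fun chain_size :: "arc list \<Rightarrow> nat" where
  "chain_size [] = 1"
| "chain_size (Short b c # cs) = Suc (chain_size cs)"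
| "chain_size (Long b ds # cs) = Suc (chain_size ds + chain_size cs)"

lemma chain_size_eq: "chain_size cs = Suc (length (chain_word cs))"
  by (induction cs rule: chain_size.induct) auto

lemma chain_size_pos: "0 < chain_size cs"
  by (simp add: chain_size_eq)

text \<open>The block of \<open>k\<close> is kept apart from the \<open>inner_blocks\<close>,
  matching the shape \<open>insert S I\<close> in \<open>interlacing_on_glue\<close>: an arc placed
  in front extends \<open>S\<close> and leaves \<open>I\<close> alone.\<close>

fun spine :: "nat \<Rightarrow> arc list \<Rightarrow> nat list" where
  "spine k [] = [k]"
| "spine k (Short b c # cs) = k # spine (Suc k) cs"
| "spine k (Long b ds # cs) = k # spine (Suc k + chain_size ds) cs"

fun inner_blocks :: "nat \<Rightarrow> arc list \<Rightarrow> nat set set" where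
  "inner_blocks k [] = {}"
| "inner_blocks k (Short b c # cs) = inner_blocks (Suc k) cs"
| "inner_blocks k (Long b ds # cs) =
     insert (set (spine (Suc k) ds)) (inner_blocks (Suc k) ds)
     \<union> inner_blocks (Suc k + chain_size ds) cs"

fun marks :: "nat \<Rightarrow> arc list \<Rightarrow> nat set" where
  "marks k [] = {}"
| "marks k (Short b c # cs) = (if b then {k} else {}) \<union> marks (Suc k) cs"
| "marks k (Long b ds # cs) =
     (if b then {k} else {}) \<union> marks (Suc k) ds \<union> marks (Suc k + chain_size ds) cs"

fun labels :: "nat \<Rightarrow> arc list \<Rightarrow> nat \<rightharpoonup> letter" where
  "labels k [] = Map.empty"
| "labels k (Short b c # cs) = (labels (Suc k) cs)(k \<mapsto> c)"
| "labels k (Long b ds # cs) = labels (Suc k) ds ++ labels (Suc k + chain_size ds) cs"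

definition all_blocks :: "nat \<Rightarrow> arc list \<Rightarrow> nat set set" where
  "all_blocks k cs = insert (set (spine k cs)) (inner_blocks k cs)"

definition decode :: "nat \<Rightarrow> arc list \<Rightarrow> aug_partition" where
  "decode k cs = \<lparr>blocks = all_blocks k cs, marked = marks k cs, arc_label = labels k cs\<rparr>"

lemma decode_simps [simp]: "blocks (decode k cs) = all_blocks k cs"
  "marked (decode k cs) = marks k cs" "arc_label (decode k cs) = labels k cs"
  by (simp_all add: decode_def)

lemma spine_hd: "\<exists>xs. spine k cs = k # xs"
  by (cases "(k, cs)" rule: spine.cases) auto

lemma start_in_spine: "k \<in> set (spine k cs)"
  using spine_hd[of k cs] by auto

lemma spine_range: "set (spine k cs) \<subseteq> {k..<k + chain_size cs}"
  by (induction k cs rule: spine.induct) (fastforce simp: chain_size_pos)+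

lemma spine_sorted: "sorted_wrt (<) (spine k cs)"
proof (induction k cs rule: spine.induct)
  case (2 k b c cs)
  then show ?case using spine_range[of "Suc k" cs] by auto
next
  case (3 k b ds cs)
  then show ?case using spine_range[of "Suc k + chain_size ds" cs] by auto
qed simp

lemma sorted_list_of_spine: "sorted_list_of_set (set (spine k cs)) = spine k cs"
  using spine_sorted[of k cs]
  by (simp add: strict_sorted_iff sorted_list_of_set.idem_if_sorted_distinct)

lemma length_spine: "length (spine k cs) = Suc (length cs)"
  by (induction k cs rule: spine.induct) auto

lemma inner_blocks_range: "B \<in> inner_blocks k cs \<Longrightarrow> B \<subseteq> {k<..<k + chain_size cs}"
proof (induction k cs arbitrary: B rule: inner_blocks.induct)
  case (3 k b ds cs)
  then show ?case using spine_range[of "Suc k" ds] by fastforce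
qed fastforce+

lemma spine_notin_inner: "set (spine k cs) \<notin> inner_blocks k cs"
proof
  assume "set (spine k cs) \<in> inner_blocks k cs"
  then have "k \<in> {k<..<k + chain_size cs}"
    using inner_blocks_range start_in_spine by blast
  then show False by simp
qed

lemma all_blocks_Nil: "all_blocks k [] = {{k}}"
  by (simp add: all_blocks_def)

text \<open>The empty union is the gap partition \<open>Q\<close> of
  \<open>interlacing_on_glue\<close>.\<close>

lemma all_blocks_Short:
  "all_blocks k (Short b c # cs) =
    {} \<union> insert (insert k (set (spine (Suc k) cs))) (inner_blocks (Suc k) cs)"
  by (simp add: all_blocks_def)

lemma all_blocks_Long:
  "all_blocks k (Long b ds # cs) = all_blocks (Suc k) ds
    \<union> insert (insert k (set (spine (Suc k + chain_size ds) cs))) (inner_blocks (Suc k + chain_size ds) cs)"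
  by (auto simp: all_blocks_def)

lemma interlacing_on_all_blocks: "interlacing_on k (k + chain_size cs) (all_blocks k cs)"
proof (induction k cs rule: inner_blocks.induct)
  case (1 k)
  then show ?case using interlacing_on_singleton[of k] by (simp add: all_blocks_Nil)
next
  case (2 k b c cs)
  show ?case
    unfolding all_blocks_Short
    by (rule interlacing_on_glue[where j = "Suc k"])
       (use 2 in \<open>auto simp: interlacing_on_empty start_in_spine spine_notin_inner all_blocks_def\<close>)
next
  case (3 k b ds cs)
  show ?case
    unfolding all_blocks_Long
    by (rule interlacing_on_glue[where j = "Suc k + chain_size ds"])
       (use 3 in \<open>simp_all add: start_in_spine spine_notin_inner all_blocks_def add_ac\<close>)
qed

lemma arcs_all_blocks_Short:
  "arcs (all_blocks k (Short b c # cs)) = insert (k, Suc k) (arcs (all_blocks (Suc k) cs))"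
  unfolding all_blocks_Short using spine_range[of "Suc k" cs] start_in_spine[of "Suc k" cs]
  by (subst arcs_glue[where j = "Suc k"]) (auto simp: all_blocks_def arcs_def)

lemma arcs_all_blocks_Long:
  "arcs (all_blocks k (Long b ds # cs)) = insert (k, Suc k + chain_size ds)
    (arcs (all_blocks (Suc k) ds) \<union> arcs (all_blocks (Suc k + chain_size ds) cs))"
  unfolding all_blocks_Long
  using spine_range[of "Suc k + chain_size ds" cs] start_in_spine[of "Suc k + chain_size ds" cs]
  by (subst arcs_glue[where j = "Suc k + chain_size ds"]) (auto simp: all_blocks_def)

lemma arcs_all_blocks_Nil: "arcs (all_blocks k []) = {}"
  by (auto simp: all_blocks_Nil arcs_def)

lemma steppers_all_blocks:
  "steppers (all_blocks k []) = {}"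
  "steppers (all_blocks k (Short b c # cs)) = insert k (steppers (all_blocks (Suc k) cs))"
  "steppers (all_blocks k (Long b ds # cs)) =
    steppers (all_blocks (Suc k) ds) \<union> steppers (all_blocks (Suc k + chain_size ds) cs)"
  using chain_size_pos[of ds]
  by (auto simp: steppers_def arcs_all_blocks_Nil arcs_all_blocks_Short arcs_all_blocks_Long)

lemma jumpers_all_blocks:
  "jumpers (all_blocks k []) = {}"
  "jumpers (all_blocks k (Short b c # cs)) = jumpers (all_blocks (Suc k) cs)"
  "jumpers (all_blocks k (Long b ds # cs)) = insert k
    (jumpers (all_blocks (Suc k) ds) \<union> jumpers (all_blocks (Suc k + chain_size ds) cs))"
  using chain_size_pos[of ds]
  by (auto simp: jumpers_def arcs_all_blocks_Nil arcs_all_blocks_Short arcs_all_blocks_Long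
      intro: exI[of _ "Suc (k + chain_size ds)"])

lemma steppers_range: "i \<in> steppers (all_blocks k cs) \<Longrightarrow> k \<le> i \<and> Suc i < k + chain_size cs"
  using arcs_range[OF interlacing_on_all_blocks] by (force simp: steppers_def)

lemma jumpers_range: "i \<in> jumpers (all_blocks k cs) \<Longrightarrow> k \<le> i \<and> Suc i < k + chain_size cs"
  using arcs_range[OF interlacing_on_all_blocks] by (force simp: jumpers_def)

lemma dom_labels: "dom (labels k cs) = steppers (all_blocks k cs)"
proof (induction k cs rule: labels.induct)
  case (2 k b c cs)
  have eq: "dom (labels k (Short b c # cs)) = insert k (dom (labels (Suc k) cs))"
    by (auto simp: dom_def)
  show ?case unfolding eq steppers_all_blocks 2 ..
qed (auto simp: steppers_all_blocks)

lemma marks_range: "marks k cs \<subseteq> {k..<k + chain_size cs}"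
proof -
  have "x \<in> marks k cs \<Longrightarrow> k \<le> x \<and> x < k + chain_size cs" for x
    by (induction k cs rule: marks.induct) (force split: if_splits)+
  then show ?thesis by auto
qed

section \<open>Decoded chains are augmented interlacing partitions\<close>

definition aug_on :: "nat \<Rightarrow> nat \<Rightarrow> aug_partition set" where
  "aug_on k e = {P. interlacing_on k e (blocks P) \<and> marked P \<subseteq> {k..<e} - Max ` blocks P \<and>
     dom (arc_label P) = steppers (blocks P)}"

lemma aug_interlacing_eq: "aug_interlacing n = aug_on 1 (Suc n)"
  by (simp add: aug_interlacing_def aug_on_def interlacing_on_def atLeastLessThanSuc_atLeastAtMost)

text \<open>Marks sit at left ends of arcs, and putting a smaller point in front of a block does not
  change its maximum.\<close>

lemma marks_not_Max: "marks k cs \<inter> Max ` all_blocks k cs = {}"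
proof (induction k cs rule: marks.induct)
  case (2 k b c cs)
  let ?S = "set (spine (Suc k) cs)"
  have M: "Max (insert k ?S) = Max ?S"
    by (rule Max_insert_less[of _ "Suc k"]) (auto simp: start_in_spine)
  then have "Max ` all_blocks k (Short b c # cs) = Max ` all_blocks (Suc k) cs"
    by (simp add: all_blocks_Short all_blocks_def[of "Suc k"])
  moreover have "Max B \<ge> Suc k" if "B \<in> all_blocks (Suc k) cs" for B
    using interlacing_onD[OF interlacing_on_all_blocks that] Max_in[of B] by fastforce
  then have "k \<notin> Max ` all_blocks (Suc k) cs" by fastforce
  ultimately show ?case using 2 by auto
next
  case (3 k b ds cs)
  let ?j = "Suc k + chain_size ds"
  let ?S = "set (spine ?j cs)"
  have M: "Max (insert k ?S) = Max ?S"
    by (rule Max_insert_less[of _ ?j]) (auto simp: start_in_spine)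
  then have eq: "Max ` all_blocks k (Long b ds # cs) = Max ` all_blocks (Suc k) ds \<union> Max ` all_blocks ?j cs"
    unfolding all_blocks_Long all_blocks_def[of ?j cs] image_Un image_insert by simp
  have cs: "Max B \<ge> ?j" if "B \<in> all_blocks ?j cs" for B
    using interlacing_onD[OF interlacing_on_all_blocks that] Max_in[of B] by fastforce
  have ds: "Suc k \<le> Max B \<and> Max B < ?j" if "B \<in> all_blocks (Suc k) ds" for B
    using interlacing_onD[OF interlacing_on_all_blocks that] Max_in[of B] by fastforce
  have "marks (Suc k) ds \<subseteq> {Suc k..<?j}" "marks ?j cs \<subseteq> {?j..}"
    using marks_range[of "Suc k" ds] marks_range[of ?j cs] by auto
  then have "marks (Suc k) ds \<inter> Max ` all_blocks ?j cs = {}"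
    "marks ?j cs \<inter> Max ` all_blocks (Suc k) ds = {}"
    using cs ds by fastforce+
  moreover have "k \<notin> Max ` all_blocks (Suc k) ds" "k \<notin> Max ` all_blocks ?j cs"
    using cs ds by fastforce+
  ultimately show ?case using 3 unfolding eq by auto
qed simp

lemma decode_in_aug_on: "decode k cs \<in> aug_on k (k + chain_size cs)"
  using marks_range marks_not_Max
  by (auto simp: aug_on_def interlacing_on_all_blocks dom_labels) blast

section \<open>Induced partitions and words\<close>

lemma ground_decode: "ground (decode k cs) = {k..<k + chain_size cs}"
  using interlacing_on_all_blocks[of k cs]
  by (simp add: ground_def interlacing_on_def partition_on_def)

lemma Min_ground_decode: "Min (ground (decode k cs)) = k"
  unfolding ground_decode by (rule Min_eqI) (auto simp: chain_size_pos)

lemma first_block_decode: "first_block (decode k cs) = set (spine k cs)"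
proof -
  have "{B \<in> all_blocks k cs. k \<in> B} = {set (spine k cs)}"
    using start_in_spine[of k cs] interlacing_on_disjoint[OF interlacing_on_all_blocks[of k cs]]
    by (auto simp: all_blocks_def)
  then show ?thesis by (simp add: first_block_def Min_ground_decode)
qed

lemma blocks_induced: "blocks (induced P I) = (\<lambda>B. B \<inter> I) ` blocks P - {{}}"
  by (auto simp: induced_def)

lemma marked_induced: "marked (induced P I) = marked P \<inter> I"
  by (simp add: induced_def)

lemma arc_label_induced: "arc_label (induced P I) = arc_label P |` {i \<in> I. Suc i \<in> I}"
  by (simp add: induced_def)

lemma induced_induced: "I \<subseteq> J \<Longrightarrow> induced (induced P J) I = induced P I"
proof (rule aug_partition.equality)
  assume IJ: "I \<subseteq> J"
  then have [simp]: "B \<inter> J \<inter> I = B \<inter> I" for B by auto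
  have drop_empty: "(\<lambda>B. B \<inter> I) ` (F - {{}}) - {{}} = (\<lambda>B. B \<inter> I) ` F - {{}}" for F by auto
  show "blocks (induced (induced P J) I) = blocks (induced P I)"
    by (simp add: blocks_induced drop_empty image_image)
  show "marked (induced (induced P J) I) = marked (induced P I)"
    using IJ by (auto simp: marked_induced)
  have "{i \<in> J. Suc i \<in> J} \<inter> {i \<in> I. Suc i \<in> I} = {i \<in> I. Suc i \<in> I}"
    using IJ by auto
  then show "arc_label (induced (induced P J) I) = arc_label (induced P I)"
    by (simp add: arc_label_induced)
qed simp

lemma image_Int_id: "(\<And>A. A \<in> F \<Longrightarrow> A \<subseteq> I) \<Longrightarrow> (\<lambda>B. B \<inter> I) ` F = F"
  using image_cong[of F F "\<lambda>B. B \<inter> I" "\<lambda>B. B"] by (simp add: Int_absorb2)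

lemma image_Int_empty: "(\<And>A. A \<in> F \<Longrightarrow> A \<inter> I = {}) \<Longrightarrow> (\<lambda>B. B \<inter> I) ` F \<subseteq> {{}}"
  by auto

lemma Un_Diff_empty_set: "{} \<notin> F \<Longrightarrow> G \<subseteq> {{}} \<Longrightarrow> F \<union> G - {{}} = F"
  by auto

lemma all_blocks_range: "A \<in> all_blocks k cs \<Longrightarrow> A \<subseteq> {k..<k + chain_size cs} \<and> A \<noteq> {}"
  using interlacing_onD[OF interlacing_on_all_blocks] by metis

lemma labels_range: "i \<in> dom (labels k cs) \<Longrightarrow> k \<le> i \<and> Suc i < k + chain_size cs"
  using steppers_range by (simp add: dom_labels)

lemma restrict_map_eq:
  assumes "\<And>i. i \<in> dom f \<Longrightarrow> i \<in> A" "\<And>i. i \<in> A \<Longrightarrow> g i = f i"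
  shows "g |` A = f"
proof (rule ext)
  fix i
  show "(g |` A) i = f i"
    using assms[of i] by (cases "i \<in> A"; cases "f i") (auto simp: restrict_map_def)
qed

text \<open>\<open>Q\<close> lies to the left of \<open>j\<close>, and so does the point
  \<open>k\<close> of the glued block, so restricting to \<open>{j..}\<close> undoes the
  gluing.\<close>

lemma induced_tail:
  assumes "k < j" "\<And>A. A \<in> Q \<Longrightarrow> A \<subseteq> {k<..<j}"
  shows "(\<lambda>B. B \<inter> {j..}) ` (Q \<union> insert (insert k (set (spine j cs))) (inner_blocks j cs)) - {{}}
    = all_blocks j cs"
proof -
  have "(\<lambda>B. B \<inter> {j..}) ` Q \<subseteq> {{}}"
    using assms(2) by (intro image_Int_empty) fastforce
  moreover have "(\<lambda>B. B \<inter> {j..}) ` all_blocks j cs = all_blocks j cs"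
    using all_blocks_range by (intro image_Int_id) fastforce
  moreover have "insert k (set (spine j cs)) \<inter> {j..} = set (spine j cs) \<inter> {j..}"
    using assms(1) by auto
  then have "(\<lambda>B. B \<inter> {j..}) ` insert (insert k (set (spine j cs))) (inner_blocks j cs)
      = (\<lambda>B. B \<inter> {j..}) ` all_blocks j cs"
    by (simp add: all_blocks_def)
  moreover have "{} \<notin> all_blocks j cs" using all_blocks_range by blast
  ultimately show ?thesis unfolding image_Un by auto
qed

text \<open>This and the next two lemmas recover the subchains from the partition. They serve both
  the injectivity of \<open>decode\<close> and the computation of its word.\<close>

lemma induced_decode_Short: "induced (decode k (Short b c # cs)) {Suc k..} = decode (Suc k) cs"
proof (rule aug_partition.equality)
  show "blocks (induced (decode k (Short b c # cs)) {Suc k..}) = blocks (decode (Suc k) cs)"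
    unfolding blocks_induced decode_simps all_blocks_Short by (rule induced_tail) auto
  show "marked (induced (decode k (Short b c # cs)) {Suc k..}) = marked (decode (Suc k) cs)"
    using marks_range[of "Suc k" cs] by (auto simp: marked_induced)
  show "arc_label (induced (decode k (Short b c # cs)) {Suc k..}) = arc_label (decode (Suc k) cs)"
    unfolding arc_label_induced decode_simps
    by (rule restrict_map_eq) (auto dest: labels_range[OF domI])
qed simp

lemma induced_decode_Long_tail:
  "induced (decode k (Long b ds # cs)) {Suc k + chain_size ds..} = decode (Suc k + chain_size ds) cs"
  (is "induced ?P {?j..} = _")
proof (rule aug_partition.equality)
  have "A \<subseteq> {k<..<?j}" if "A \<in> all_blocks (Suc k) ds" for A
    using all_blocks_range[OF that] by auto
  then show "blocks (induced ?P {?j..}) = blocks (decode ?j cs)"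
    unfolding blocks_induced decode_simps all_blocks_Long by (intro induced_tail) auto
  show "marked (induced ?P {?j..}) = marked (decode ?j cs)"
    using marks_range[of ?j cs] marks_range[of "Suc k" ds] by (auto simp: marked_induced)
  show "arc_label (induced ?P {?j..}) = arc_label (decode ?j cs)"
    unfolding arc_label_induced decode_simps
  proof (rule restrict_map_eq)
    fix i assume "i \<in> {i \<in> {?j..}. Suc i \<in> {?j..}}"
    then have "i \<notin> dom (labels (Suc k) ds)" using labels_range[of i "Suc k" ds] by auto
    then show "labels k (Long b ds # cs) i = labels ?j cs i"
      by (simp add: map_add_dom_app_simps)
  qed (use labels_range in force)
qed simp

lemma induced_decode_Long_gap:
  "induced (decode k (Long b ds # cs)) {k<..<Suc k + chain_size ds} = decode (Suc k) ds"
  (is "induced ?P ?I = _")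
proof (rule aug_partition.equality)
  let ?j = "Suc k + chain_size ds"
  have "(\<lambda>B. B \<inter> ?I) ` all_blocks (Suc k) ds = all_blocks (Suc k) ds"
    using all_blocks_range[of _ "Suc k" ds] by (intro image_Int_id) fastforce
  moreover have "(\<lambda>B. B \<inter> ?I) ` insert (insert k (set (spine ?j cs))) (inner_blocks ?j cs) \<subseteq> {{}}"
  proof (rule image_Int_empty)
    fix A assume "A \<in> insert (insert k (set (spine ?j cs))) (inner_blocks ?j cs)"
    then have "A \<subseteq> insert k {?j..}"
      using spine_range[of ?j cs] inner_blocks_range[of A ?j cs] by fastforce
    then show "A \<inter> ?I = {}" by fastforce
  qed
  moreover have "{} \<notin> all_blocks (Suc k) ds" using all_blocks_range by blast
  ultimately show "blocks (induced ?P ?I) = blocks (decode (Suc k) ds)"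
    unfolding blocks_induced decode_simps all_blocks_Long image_Un by (metis Un_Diff_empty_set)
  show "marked (induced ?P ?I) = marked (decode (Suc k) ds)"
    using marks_range[of ?j cs] marks_range[of "Suc k" ds] by (auto simp: marked_induced)
  show "arc_label (induced ?P ?I) = arc_label (decode (Suc k) ds)"
    unfolding arc_label_induced decode_simps
  proof (rule restrict_map_eq)
    fix i assume "i \<in> {i \<in> ?I. Suc i \<in> ?I}"
    then have "i \<notin> dom (labels ?j cs)" using labels_range[of i ?j cs] by auto
    then show "labels k (Long b ds # cs) i = labels (Suc k) ds i"
      by (simp add: map_add_dom_app_simps)
  qed (use labels_range in force)
qed simp

lemma start_in_marks:
  "k \<in> marks k (Short b c # cs) \<longleftrightarrow> b" "k \<in> marks k (Long b ds # cs) \<longleftrightarrow> b"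
  using marks_range[of "Suc k" cs] marks_range[of "Suc k" ds]
    marks_range[of "Suc k + chain_size ds" cs] by auto

section \<open>Injectivity of decoding\<close>

lemma spine_eq_if_decode_eq:
  assumes "decode k cs = decode k cs'"
  shows "spine k cs = spine k cs'"
proof -
  have "set (spine k cs) = set (spine k cs')"
    using assms first_block_decode[of k cs] first_block_decode[of k cs'] by simp
  then show ?thesis
    by (metis sorted_list_of_spine)
qed

text \<open>The second point of the block of \<open>k\<close> shows whether the first arc is short
  or long and how large its gap is. Mark and label are read off at \<open>k\<close>, and the
  subchains follow by induction from the induced partitions.\<close>

lemma decode_inject: "decode k cs = decode k cs' \<Longrightarrow> cs = cs'"
proof (induction k cs arbitrary: cs' rule: inner_blocks.induct)
  case (1 k)
  then have "spine k [] = spine k cs'"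
    by (rule spine_eq_if_decode_eq)
  then have "length (spine k []) = length (spine k cs')" by (rule arg_cong)
  then show ?case by (simp only: length_spine) simp
next
  case (2 k b c cs)
  have sp: "spine k (Short b c # cs) = spine k cs'"
    using 2(2) by (rule spine_eq_if_decode_eq)
  have mk: "marks k (Short b c # cs) = marks k cs'" and lb: "labels k (Short b c # cs) = labels k cs'"
    using 2(2) by (simp_all add: decode_def)
  show ?case
  proof (cases cs' rule: chain_word.cases)
    case 1
    then show ?thesis using sp length_spine[of "Suc k" cs] by auto
  next
    case (2 b' c' cs'')
    have "b = b'" using mk start_in_marks(1) unfolding 2 by metis
    moreover have "c = c'" using fun_cong[OF lb, of k] unfolding 2 by simp
    moreover have "decode (Suc k) cs = decode (Suc k) cs''"
      using arg_cong[OF \<open>decode k (Short b c # cs) = decode k cs'\<close>, of "\<lambda>P. induced P {Suc k..}"]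
      unfolding 2 induced_decode_Short .
    ultimately show ?thesis using 2 \<open>\<And>cs'. decode (Suc k) cs = decode (Suc k) cs' \<Longrightarrow> cs = cs'\<close> by simp
  next
    case (3 b' ds' cs'')
    then show ?thesis
      using sp spine_hd[of "Suc k" cs] spine_hd[of "Suc k + chain_size ds'" cs''] chain_size_pos[of ds']
      by auto
  qed
next
  case (3 k b ds cs)
  have sp: "spine k (Long b ds # cs) = spine k cs'"
    using 3(3) by (rule spine_eq_if_decode_eq)
  have mk: "marks k (Long b ds # cs) = marks k cs'"
    using 3(3) by (simp add: decode_def)
  show ?case
  proof (cases cs' rule: chain_word.cases)
    case 1
    then show ?thesis using sp length_spine[of "Suc k + chain_size ds" cs] by auto
  next
    case (2 b' c' cs'')
    then show ?thesis
      using sp spine_hd[of "Suc k" cs''] spine_hd[of "Suc k + chain_size ds" cs] chain_size_pos[of ds]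
      by auto
  next
    case L: (3 b' ds' cs'')
    have b: "b = b'" using mk start_in_marks(2) unfolding L by metis
    have sz: "chain_size ds = chain_size ds'"
      using sp spine_hd[of "Suc k + chain_size ds" cs] spine_hd[of "Suc k + chain_size ds'" cs'']
      unfolding L by auto
    have "decode (Suc k) ds = decode (Suc k) ds'"
      using arg_cong[OF 3(3), of "\<lambda>P. induced P {k<..<Suc k + chain_size ds}"]
      unfolding L induced_decode_Long_gap unfolding sz induced_decode_Long_gap .
    moreover have "decode (Suc k + chain_size ds) cs = decode (Suc k + chain_size ds) cs''"
      using arg_cong[OF 3(3), of "\<lambda>P. induced P {Suc k + chain_size ds..}"]
      unfolding L induced_decode_Long_tail unfolding sz induced_decode_Long_tail .
    ultimately show ?thesis using L b 3(1,2) by simp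
  qed
qed

section \<open>The word of a decoded chain\<close>

fun gap_word :: "aug_partition \<Rightarrow> nat list \<Rightarrow> letter list" where
  "gap_word P (x # y # xs) =
     (if y = Suc x then [the (arc_label P x)] else D # aug_word (induced P {x<..<y}) @ [U])
     @ gap_word P (y # xs)"
| "gap_word P xs = []"

text \<open>The branch of \<open>aug_word\<close> for several blocks, with the list of components as
  a parameter. For one component it reduces to \<open>arc_word\<close>, so it covers the other
  branch too.\<close>

definition components_word :: "aug_partition \<Rightarrow> nat list list \<Rightarrow> letter list" where
  "components_word P Cs = concat (map (\<lambda>i. arc_word P (Cs ! i) @
      [D] @ aug_word (induced P {last (Cs ! i) <..< hd (Cs ! (i + 1))}) @ [U]) [0..<length Cs - 1])
    @ arc_word P (last Cs)"

lemma components_word_single: "components_word P [C] = arc_word P C"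
  by (simp add: components_word_def)

lemma components_word_Cons: "components_word P (C # C' # Cs) =
    arc_word P C @ [D] @ aug_word (induced P {last C <..< hd C'}) @ [U] @ components_word P (C' # Cs)"
proof -
  have "[0..<length (C # C' # Cs) - 1] = 0 # map Suc [0..<length (C' # Cs) - 1]"
    by (simp add: upt_conv_Cons map_Suc_upt del: upt_Suc)
  then show ?thesis
    unfolding components_word_def by (simp add: o_def del: upt_Suc)
qed

lemma break_after_nonempty: "xs \<noteq> [] \<Longrightarrow> break_after Q xs \<noteq> []"
  by (cases "(Q, xs)" rule: break_after.cases) auto

lemma hd_hd_break_after: "xs \<noteq> [] \<Longrightarrow> hd (hd (break_after Q xs)) = hd xs"
  by (cases "(Q, xs)" rule: break_after.cases) auto

lemma break_after_single: "xs \<noteq> [] \<Longrightarrow> (\<And>x. x \<in> set (butlast xs) \<Longrightarrow> \<not> Q x) \<Longrightarrow> break_after Q xs = [xs]"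
  by (induction Q xs rule: break_after.induct) auto

lemma arc_word_Cons:
  assumes "C \<noteq> []" "\<forall>z \<in> set C. x < z" "hd C = Suc x"
  shows "arc_word P (x # C) = the (arc_label P x) # arc_word P C"
proof -
  have "Suc x \<in> set C" using assms by (metis hd_in_set)
  moreover have "filter (\<lambda>i. Suc i \<in> set (x # C)) C = filter (\<lambda>i. Suc i \<in> set C) C"
    using assms(2) by (intro filter_cong) auto
  ultimately show ?thesis by (simp add: arc_word_def)
qed

text \<open>Passes from reading a block by maximal runs of short arcs to reading it arc by arc, as
  chains do. The breaking condition keeps referring to the whole block \<open>A\<close> while the
  induction runs over its suffixes; hence \<open>A\<close> and \<open>xs\<close> need only agree
  from \<open>hd xs\<close> on.\<close>

lemma components_word_break_after:
  "xs \<noteq> [] \<Longrightarrow> sorted_wrt (<) xs \<Longrightarrow> A \<inter> {hd xs..} = set xs \<Longrightarrow>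
    components_word P (break_after (\<lambda>i. Suc i \<notin> A) xs) = gap_word P xs"
proof (induction xs rule: induct_list012)
  case (2 x)
  then show ?case by (simp add: components_word_single arc_word_def)
next
  case (3 x y xs)
  let ?b = "break_after (\<lambda>i. Suc i \<notin> A) (y # xs)"
  obtain C Cs where b: "?b = C # Cs" using break_after_nonempty by (metis list.distinct(1) list.exhaust)
  have "x < y" and sorted: "\<forall>z \<in> set xs. y < z" using "3.prems"(2) by auto
  have "A \<inter> {y..} = set (y # xs)"
  proof -
    have "A \<inter> {y..} = (A \<inter> {x..}) \<inter> {y..}" using \<open>x < y\<close> by auto
    also have "\<dots> = set (y # xs)" using "3.prems"(3) \<open>x < y\<close> sorted by auto
    finally show ?thesis .
  qed
  then have IH: "components_word P ?b = gap_word P (y # xs)"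
    using 3 by simp
  have C: "C \<noteq> []" "set C \<subseteq> set (y # xs)" "hd C = y"
    using set_break_after[of C "\<lambda>i. Suc i \<notin> A" "y # xs"]
      hd_hd_break_after[of "y # xs" "\<lambda>i. Suc i \<notin> A"] b by auto
  have "\<forall>z \<in> set (y # xs). x < z" using \<open>x < y\<close> sorted by auto
  then have xC: "\<forall>z \<in> set C. x < z" using C(2) by blast
  have "Suc x \<in> A \<longleftrightarrow> Suc x \<in> A \<inter> {x..}" by simp
  also have "\<dots> \<longleftrightarrow> y = Suc x" using "3.prems"(3) \<open>x < y\<close> sorted by auto
  finally have Q: "Suc x \<in> A \<longleftrightarrow> y = Suc x" .
  show ?case
  proof (cases "y = Suc x")
    case True
    have "components_word P ((x # C) # Cs) = the (arc_label P x) # components_word P (C # Cs)"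
    proof -
      have "arc_word P (x # C) = the (arc_label P x) # arc_word P C"
        using C True xC by (intro arc_word_Cons) auto
      then show ?thesis
        using C by (cases Cs) (simp_all add: components_word_single components_word_Cons)
    qed
    then show ?thesis using True Q b IH by simp
  next
    case False
    have "arc_word P [x] = []" by (simp add: arc_word_def)
    then show ?thesis
      using False Q b C IH by (simp add: components_word_Cons)
  qed
qed simp

lemma aug_word_decode_gap_word: "aug_word (decode k cs) = gap_word (decode k cs) (spine k cs)"
proof -
  let ?P = "decode k cs" and ?Q = "\<lambda>i. Suc i \<notin> set (spine k cs)"
  have ne: "spine k cs \<noteq> []" using spine_hd[of k cs] by auto
  have hd: "hd (spine k cs) = k" using spine_hd[of k cs] by auto
  have "set (spine k cs) \<inter> {hd (spine k cs)..} = set (spine k cs)"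
    using spine_range[of k cs] hd by auto
  then have eq: "components_word ?P (break_after ?Q (spine k cs)) = gap_word ?P (spine k cs)"
    using components_word_break_after[OF ne spine_sorted] by blast
  show ?thesis
  proof (cases "card (blocks ?P) = 1")
    case True
    then have "blocks ?P = {set (spine k cs)}"
      by (auto simp: card_1_singleton_iff all_blocks_def)
    then have g: "ground ?P = set (spine k cs)" by (simp add: ground_def)
    \<comment> \<open>A single block is the whole interval, so every point but the last is followed
      by its successor and there is only one component.\<close>
    have "\<not> ?Q x" if "x \<in> set (butlast (spine k cs))" for x
    proof -
      have "x < last (spine k cs)"
        using that spine_sorted[of k cs] ne
        by (metis append_butlast_last_id sorted_wrt_append list.set_intros(1))
      moreover have "last (spine k cs) \<in> {k..<k + chain_size cs}"
        using ne spine_range[of k cs] last_in_set by blast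
      moreover have "x \<in> {k..<k + chain_size cs}"
        using that spine_range[of k cs] in_set_butlastD by fast
      ultimately have "Suc x \<in> ground ?P" unfolding ground_decode by auto
      then show ?thesis using g by simp
    qed
    then have "break_after ?Q (spine k cs) = [spine k cs]"
      using ne by (intro break_after_single)
    then show ?thesis
      using True eq by (subst aug_word.simps) (simp add: g sorted_list_of_spine components_word_single)
  next
    case False
    then show ?thesis
      using eq by (subst aug_word.simps)
        (simp add: components_word_def short_components_def first_block_decode sorted_list_of_spine Let_def)
  qed
qed

lemma gap_word_induced:
  "sorted_wrt (<) xs \<Longrightarrow> set xs \<subseteq> {j..} \<Longrightarrow> gap_word (induced P {j..}) xs = gap_word P xs"
proof (induction xs rule: induct_list012)
  case (3 x y xs)
  have "induced (induced P {j..}) {x<..<y} = induced P {x<..<y}"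
    using 3 by (intro induced_induced) auto
  then show ?case using 3 by (simp add: arc_label_induced)
qed simp_all

lemma aug_word_decode: "aug_word (decode k cs) = chain_word cs"
proof (induction k cs rule: inner_blocks.induct)
  case (1 k)
  show ?case by (simp add: aug_word_decode_gap_word)
next
  case (2 k b c cs)
  let ?P = "decode k (Short b c # cs)" and ?xs = "spine (Suc k) cs"
  obtain xs where xs: "?xs = Suc k # xs" using spine_hd by blast
  have "aug_word ?P = c # gap_word ?P ?xs"
    by (simp add: aug_word_decode_gap_word xs)
  also have "gap_word ?P ?xs = gap_word (decode (Suc k) cs) ?xs"
    using spine_range[of "Suc k" cs]
    by (subst induced_decode_Short[of k b c, symmetric], subst gap_word_induced) (auto simp: spine_sorted)
  finally show ?case using 2 by (simp add: aug_word_decode_gap_word)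
next
  case (3 k b ds cs)
  let ?j = "Suc k + chain_size ds"
  let ?P = "decode k (Long b ds # cs)" and ?xs = "spine ?j cs"
  obtain xs where xs: "?xs = ?j # xs" using spine_hd by blast
  have "aug_word ?P = D # aug_word (induced ?P {k<..<?j}) @ [U] @ gap_word ?P ?xs"
    using chain_size_pos[of ds] by (simp add: aug_word_decode_gap_word xs[simplified])
  also have "gap_word ?P ?xs = gap_word (decode ?j cs) ?xs"
    using spine_range[of ?j cs]
    by (subst induced_decode_Long_tail[of k b, symmetric], subst gap_word_induced) (auto simp: spine_sorted)
  finally show ?case
    using 3 by (simp only: induced_decode_Long_gap) (simp add: aug_word_decode_gap_word)
qed

section \<open>Surjectivity of decoding\<close>

text \<open>The converse of \<open>interlacing_on_glue\<close>, with \<open>j\<close> the successor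
  of \<open>k\<close> in its block. As \<open>k\<close> and \<open>j\<close> share a block,
  noncrossing confines every other block to the gap or to the right of \<open>j\<close>. Removing
  \<open>k\<close> makes \<open>j\<close> a new minimum, but all blocks of the right part have
  maximum at least \<open>j\<close>, so none ends at \<open>j - 1\<close>.\<close>

lemma interlacing_on_split:
  assumes F: "interlacing_on k e F" and B: "B \<in> F" "k \<in> B" "B \<noteq> {k}"
  obtains j Q S I where "k < j" "j < e" "j \<in> S" "\<And>x. x \<in> S \<Longrightarrow> j \<le> x" "S \<notin> I"
    "interlacing_on (Suc k) j Q" "interlacing_on j e (insert S I)"
    "F = Q \<union> insert (insert k S) I"
proof -
  define j where "j = Min (B - {k})"
  define Q where "Q = {A \<in> F. A \<subseteq> {k<..<j}}"
  define I where "I = {A \<in> F - {B}. A \<subseteq> {j..<e}}"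
  define S where "S = B - {k}"
  have rB: "B \<subseteq> {k..<e}" "finite B" using interlacing_onD[OF F B(1)] by auto
  have "B - {k} \<noteq> {}" using B by auto
  then have jS: "j \<in> S" using rB(2) Min_in[of "B - {k}"] by (simp add: j_def S_def)
  have Smin: "j \<le> x" if "x \<in> S" for x using that rB(2) by (simp add: j_def S_def)
  have jB: "j \<in> B" and "k < j" "j < e" using jS rB by (force simp: S_def)+
  have dj: "A = A'" if "A \<in> F" "A' \<in> F" "x \<in> A" "x \<in> A'" for A A' x
    using interlacing_on_disjoint[OF F that] .
  have rS: "S \<subseteq> {j..<e}"
  proof
    fix x assume "x \<in> S"
    then show "x \<in> {j..<e}" using Smin[of x] rB(1) by (auto simp: S_def)
  qed
  have side: "A \<subseteq> {k<..<j} \<or> A \<subseteq> {j..<e}" if "A \<in> F" "A \<noteq> B" for A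
  proof (rule ccontr)
    have A: "A \<subseteq> {k..<e}" "k \<notin> A" "j \<notin> A"
      using interlacing_onD(1)[OF F] dj[OF that(1) B(1)] that B(2) jB by blast+
    assume "\<not> (A \<subseteq> {k<..<j} \<or> A \<subseteq> {j..<e})"
    then obtain a c where ac: "a \<in> A" "c \<in> A" "a \<notin> {j..<e}" "c \<notin> {k<..<j}" by blast
    then have "a \<in> {k..<e}" "c \<in> {k..<e}" "a \<noteq> k" "c \<noteq> k" "c \<noteq> j" using A by blast+
    then have "k < a" "a < j" "j < c" using ac by auto
    from interlacing_on_crossing[OF F B(1) that(1) this] ac B jB that(2) show False by simp
  qed
  have Fs: "F = Q \<union> insert (insert k S) I"
    using side B by (auto simp: Q_def I_def S_def insert_absorb)
  have UF: "\<Union>F = {k..<e}" and djF: "disjoint F" and ilF: "interlacing F"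
    using F by (simp_all add: interlacing_on_def partition_on_def)
  have ne: "A \<noteq> {}" if "A \<in> F" for A using interlacing_onD(2)[OF F that] .
  have QF: "Q \<subseteq> F" and IF: "I \<subseteq> F" by (auto simp: Q_def I_def)
  have nc: "noncrossing G" if "G \<subseteq> F" for G
    unfolding noncrossing_def
  proof clarify
    fix p q a b c d assume "p \<in> G" "q \<in> G" "p \<noteq> q"
      and "a < b" "b < c" "c < d" "a \<in> p" "c \<in> p" "b \<in> q" "d \<in> q"
    then show False
      using interlacing_on_crossing[OF F, of p q a b c d] that by auto
  qed
  have SI: "S \<notin> I" using dj[of S B j] jS jB B(1) by (auto simp: I_def)
  have IQ: "interlacing_on (Suc k) j Q"
    unfolding interlacing_on_def
  proof (intro conjI partition_onI)
    show "\<Union>Q = {Suc k..<j}"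
    proof (intro equalityI subsetI)
      fix x assume x: "x \<in> {Suc k..<j}"
      then have "x \<in> \<Union>F" using UF \<open>j < e\<close> by auto
      then obtain A where A: "A \<in> F" "x \<in> A" by blast
      have "x \<notin> B" using x Smin[of x] by (auto simp: S_def)
      then have "A \<subseteq> {k<..<j}" using side[of A] A x by fastforce
      then show "x \<in> \<Union>Q" using A by (auto simp: Q_def)
    qed (auto simp: Q_def)
    show "disjnt p q" if "p \<in> Q" "q \<in> Q" "p \<noteq> q" for p q
      using that djF QF by (auto simp: disjnt_def disjoint_def)
    show "{} \<notin> Q" using QF ne by auto
    show "noncrossing Q" by (rule nc[OF QF])
    show "interlacing Q" using ilF QF by (auto simp: interlacing_def)
  qed
  have II: "interlacing_on j e (insert S I)"
    unfolding interlacing_on_def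
  proof (intro conjI partition_onI)
    have "\<Union>(insert S I) \<subseteq> {j..<e}" using rS by (auto simp: I_def)
    moreover have "x \<in> \<Union>(insert S I)" if x: "x \<in> {j..<e}" for x
    proof -
      have "x \<in> \<Union>F" using x UF \<open>k < j\<close> by auto
      then obtain A where A: "A \<in> F" "x \<in> A" by blast
      show ?thesis
      proof (cases "A = B")
        case True
        then show ?thesis using A x \<open>k < j\<close> by (auto simp: S_def)
      next
        case False
        then have "A \<subseteq> {j..<e}" using side[of A] A x by fastforce
        then show ?thesis using A False by (auto simp: I_def)
      qed
    qed
    ultimately show "\<Union>(insert S I) = {j..<e}" by blast
    show "disjnt p q" if pq: "p \<in> insert S I" "q \<in> insert S I" "p \<noteq> q" for p q
      unfolding disjnt_iff
    proof (intro allI notI)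
      fix x assume "x \<in> p \<and> x \<in> q"
      then show False using pq dj[of _ B x] dj[of p q x] B(1) by (auto simp: I_def S_def)
    qed
    show "{} \<notin> insert S I" using IF ne jS by auto
    show "noncrossing (insert S I)"
      unfolding noncrossing_def
    proof (clarify)
      fix p q a b c d
      assume pq: "p \<in> insert S I" "q \<in> insert S I" "p \<noteq> q" and lt: "a < b" "b < c" "c < d"
        and mem: "a \<in> p" "c \<in> p" "b \<in> q" "d \<in> q"
      \<comment> \<open>Enlarging \<open>S\<close> back to \<open>B\<close> turns a crossing in the
        right part into a crossing in \<open>F\<close>.\<close>
      let ?g = "\<lambda>p. if p = S then B else p"
      have g: "?g p \<in> F" "?g q \<in> F" "p \<subseteq> ?g p" "q \<subseteq> ?g q"
        using pq B(1) IF by (auto simp: S_def)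
      have "?g p = ?g q"
        by (rule interlacing_on_crossing[OF F g(1,2) lt]) (use mem g(3,4) in blast)+
      then show False using pq by (auto simp: I_def split: if_splits)
    qed
    show "interlacing (insert S I)"
      unfolding interlacing_def
    proof (clarify)
      fix p q assume pq: "p \<in> insert S I" "q \<in> insert S I" and eq: "Max p + 1 = Min q"
      have B_eq: "B = insert k S" using B by (auto simp: S_def)
      have MS: "Max S = Max B"
        unfolding B_eq using Max_insert_less[of S j k] rB(2) jS \<open>k < j\<close> by (simp add: S_def)
      have MF: "Max p \<in> Max ` F" using pq(1) MS B(1) IF by auto
      have p: "p \<subseteq> {j..<e}" using pq(1) rS by (auto simp: I_def)
      moreover have "p \<noteq> {}" using pq(1) jS IF ne by blast
      then have "Max p \<in> p" using finite_subset[OF p] by simp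
      ultimately have "Max p \<in> {j..<e}" by (rule subsetD)
      then have "Max p \<ge> j" by simp
      moreover have "Min S = j" using jS Smin rB(2) by (intro Min_eqI) (auto simp: S_def)
      ultimately have "q \<in> I" using pq(2) eq by auto
      then show False using MF eq ilF IF unfolding interlacing_def by (metis image_eqI subsetD)
    qed
  qed
  show thesis
    using that[OF \<open>k < j\<close> \<open>j < e\<close> jS Smin SI IQ II Fs] .
qed

lemma arcs_singleton: "arcs {{k}} = {}"
  by (auto simp: arcs_def)

text \<open>If \<open>{k}\<close> is a block and \<open>k + 1\<close> belongs to the interval, then
  the block of \<open>k + 1\<close> has minimum \<open>k + 1\<close>, one more than the maximum of
  \<open>{k}\<close>. Interlacing forbids this. It is the reason why one outermost block spans the
  whole interval.\<close>

lemma aug_on_singleton: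
  assumes "P \<in> aug_on k e" "{k} \<in> blocks P"
  shows "e = Suc k \<and> P = decode k []"
proof -
  have F: "interlacing_on k e (blocks P)" using assms(1) by (simp add: aug_on_def)
  have UF: "\<Union>(blocks P) = {k..<e}" and ilF: "interlacing (blocks P)"
    using F by (simp_all add: interlacing_on_def partition_on_def)
  have "k < e" using interlacing_onD(1)[OF F assms(2)] by simp
  have e: "e = Suc k"
  proof (rule ccontr)
    assume "e \<noteq> Suc k"
    then have "Suc k \<in> \<Union>(blocks P)" using \<open>k < e\<close> UF by auto
    then obtain C where C: "C \<in> blocks P" "Suc k \<in> C" by blast
    then have "k \<notin> C" using interlacing_on_disjoint[OF F C(1) assms(2), of k] by auto
    then have "Suc k \<le> y" if "y \<in> C" for y
      using that interlacing_onD(1)[OF F C(1)] by (cases "y = k") fastforce+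
    then have "Min C = Suc k"
      using C interlacing_onD(3)[OF F C(1)] by (intro Min_eqI) auto
    then show False
      using ilF C(1) assms(2) unfolding interlacing_def by (force simp: image_iff)
  qed
  have "A = {k}" if "A \<in> blocks P" for A
    using interlacing_onD(1,2)[OF F that] e by auto
  then have b: "blocks P = {{k}}" using assms(2) by blast
  have "steppers {{k}} = {}" by (simp add: steppers_def arcs_singleton)
  then have "marked P = {}" "arc_label P = Map.empty"
    using assms(1) e by (auto simp: aug_on_def b)
  then show ?thesis
    using e b by (auto simp: decode_def all_blocks_def intro!: aug_partition.equality)
qed

text \<open>Cutting at the first arc leaves \<open>P1\<close> in the gap and \<open>P2\<close> from
  \<open>j\<close> on, both on shorter intervals. The premise \<open>k < e\<close> keeps out the
  empty partition, which no chain encodes; so \<open>P1\<close> is decoded only if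
  \<open>j \<noteq> Suc k\<close>.\<close>

lemma decode_surj:
  "P \<in> aug_on k e \<Longrightarrow> k < e \<Longrightarrow> \<exists>cs. k + chain_size cs = e \<and> decode k cs = P"
proof (induction "e - k" arbitrary: k e P rule: less_induct)
  case less
  define F M L where "F = blocks P" "M = marked P" "L = arc_label P"
  note P = this
  have F: "interlacing_on k e F" and M: "M \<subseteq> {k..<e}" "M \<inter> Max ` F = {}" and L: "dom L = steppers F"
    using less.prems by (auto simp: aug_on_def P)
  have "k \<in> \<Union>F" using F less.prems by (simp add: interlacing_on_def partition_on_def)
  then obtain B where B: "B \<in> F" "k \<in> B" by blast
  show ?case
  proof (cases "B = {k}")
    case True
    then show ?thesis
      using aug_on_singleton[OF less.prems(1)] B by (intro exI[of _ "[]"]) (simp add: P)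
  next
    case False
    obtain j Q S I where
      j: "k < j" "j < e" "j \<in> S" "\<And>x. x \<in> S \<Longrightarrow> j \<le> x" "S \<notin> I"
      and Q: "interlacing_on (Suc k) j Q" and SI: "interlacing_on j e (insert S I)"
      and Fs: "F = Q \<union> insert (insert k S) I"
      by (rule interlacing_on_split[OF F B False]) (rule that)
    have fS: "finite S" using interlacing_onD(3)[OF SI] by simp
    have arcs_F: "arcs F = insert (k, j) (arcs Q \<union> arcs (insert S I))"
      unfolding Fs by (rule arcs_glue[OF j(1,3,4)])
    \<comment> \<open>Apart from \<open>(k, j)\<close>, every arc lies entirely in the gap or
      entirely from \<open>j\<close> on, so the labels can be distributed over the two
      parts.\<close>
    have step_Q: "i \<in> steppers F \<longleftrightarrow> i \<in> steppers Q" if "i \<in> {k<..<j}" for i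
      using that arcs_range[OF SI] by (fastforce simp: steppers_def arcs_F)
    have step_SI: "i \<in> steppers F \<longleftrightarrow> i \<in> steppers (insert S I)" if "i \<in> {j..}" for i
      using that arcs_range[OF Q] j(1) by (fastforce simp: steppers_def arcs_F)
    have step_k: "k \<in> steppers F \<longleftrightarrow> j = Suc k"
      using arcs_range[OF Q] arcs_range[OF SI] j(1) by (fastforce simp: steppers_def arcs_F)
    have dom_ge: "k \<le> i" if "L i = Some c" for i c
    proof -
      have "i \<in> steppers F" using that L by blast
      then show ?thesis using arcs_range[OF F] by (force simp: steppers_def)
    qed
    have dom_k: "L k = None" if "j \<noteq> Suc k"
    proof -
      have "k \<notin> dom L" using that step_k unfolding L by simp
      then show ?thesis by (simp add: domIff)
    qed
    \<comment> \<open>Cutting off \<open>k\<close> creates no new block maximum, so the marks remain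
      admissible in both parts.\<close>
    have MaxQ: "Max ` Q \<subseteq> Max ` F" and MaxSI: "Max ` insert S I \<subseteq> Max ` F"
      using Max_insert_less[OF fS j(3,1)] by (auto simp: Fs image_iff)
    have M_split: "(if k \<in> M then {k} else {}) \<union> M \<inter> J = M" if "J = {k<..}" for J
    proof -
      have "M \<subseteq> {k} \<union> J" using M(1) that by fastforce
      then show ?thesis using that by (cases "k \<in> M") auto
    qed
    have M_Diff: "M \<inter> J \<subseteq> {k..<e} \<inter> J - Y" if "Y \<subseteq> Max ` F" for J Y
      using M that by blast
    define P1 where "P1 = \<lparr>blocks = Q, marked = M \<inter> {k<..<j}, arc_label = L |` {k<..<j}\<rparr>"
    define P2 where "P2 = \<lparr>blocks = insert S I, marked = M \<inter> {j..}, arc_label = L |` {j..}\<rparr>"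
    have "P2 \<in> aug_on j e"
    proof -
      have "dom (L |` {j..}) = steppers (insert S I)"
      proof -
        have "steppers (insert S I) \<subseteq> {j..}"
          using arcs_range[OF SI] by (force simp: steppers_def)
        then show ?thesis using step_SI unfolding dom_restrict L by blast
      qed
      moreover have "M \<inter> {j..} \<subseteq> {j..<e} - Max ` insert S I"
      proof -
        have "{k..<e} \<inter> {j..} = {j..<e}" using j(1) by auto
        then show ?thesis using M_Diff[OF MaxSI, of "{j..}"] by metis
      qed
      ultimately show ?thesis using SI by (simp add: aug_on_def P2_def)
    qed
    then have "\<exists>cs. j + chain_size cs = e \<and> decode j cs = P2"
      using j(1,2) by (intro less.hyps) auto
    then obtain cs where cs: "j + chain_size cs = e" "decode j cs = P2" by blast
    then have bl: "all_blocks j cs = insert S I" and mk: "marks j cs = M \<inter> {j..}"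
      and lb: "labels j cs = L |` {j..}"
      by (simp_all add: decode_def P2_def)
    have "set (spine j cs) \<in> insert S I" using bl by (auto simp: all_blocks_def)
    then have sp: "set (spine j cs) = S"
      using interlacing_on_disjoint[OF SI _ _ start_in_spine j(3)] by simp
    then have inn: "inner_blocks j cs = I"
      using bl j(5) spine_notin_inner[of j cs] unfolding all_blocks_def by (metis insert_ident)
    let ?b = "k \<in> M"
    show ?thesis
    proof (cases "j = Suc k")
      case True
      then have "Q = {}" using interlacing_onD(1,2)[OF Q] by fastforce
      obtain c where c: "L k = Some c" using True step_k L by blast
      have "decode k (Short ?b c # cs) = P"
      proof (rule aug_partition.equality)
        show "blocks (decode k (Short ?b c # cs)) = blocks P"
          unfolding decode_simps all_blocks_Short using sp inn Fs True \<open>Q = {}\<close> by (simp add: P)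
        show "marked (decode k (Short ?b c # cs)) = marked P"
          unfolding decode_simps marks.simps P(2)[symmetric]
          using mk M_split[of "{Suc k..}"] by (simp add: True atLeast_Suc_greaterThan)
        have "((L |` {Suc k..})(k \<mapsto> c)) i = L i" for i
          using c dom_ge[of i] by (cases "i = k"; cases "L i") (auto simp: restrict_map_def)
        then have "(L |` {Suc k..})(k \<mapsto> c) = L" by (rule ext)
        then show "arc_label (decode k (Short ?b c # cs)) = arc_label P"
          using lb unfolding decode_simps labels.simps True P(3)[symmetric] by metis
      qed simp
      then show ?thesis using cs True by (intro exI[of _ "Short ?b c # cs"]) simp
    next
      case False
      have "P1 \<in> aug_on (Suc k) j"
      proof -
        have "dom (L |` {k<..<j}) = steppers Q"
        proof -
          have "steppers Q \<subseteq> {k<..<j}"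
            using arcs_range[OF Q] by (force simp: steppers_def)
          then show ?thesis using step_Q unfolding dom_restrict L by blast
        qed
        moreover have "M \<inter> {k<..<j} \<subseteq> {Suc k..<j} - Max ` Q"
        proof -
          have "{k..<e} \<inter> {k<..<j} = {Suc k..<j}" using j(2) by auto
          then show ?thesis using M_Diff[OF MaxQ, of "{k<..<j}"] by metis
        qed
        ultimately show ?thesis using Q by (simp add: aug_on_def P1_def)
      qed
      then have "\<exists>ds. Suc k + chain_size ds = j \<and> decode (Suc k) ds = P1"
        using j(1,2) False by (intro less.hyps) auto
      then obtain ds where ds: "Suc k + chain_size ds = j" "decode (Suc k) ds = P1" by blast
      then have bl': "all_blocks (Suc k) ds = Q" and mk': "marks (Suc k) ds = M \<inter> {k<..<j}"
        and lb': "labels (Suc k) ds = L |` {k<..<j}"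
        by (simp_all add: decode_def P1_def)
      have "decode k (Long ?b ds # cs) = P"
      proof (rule aug_partition.equality)
        show "blocks (decode k (Long ?b ds # cs)) = blocks P"
          unfolding decode_simps all_blocks_Long ds(1) bl' sp inn by (simp add: Fs flip: P(1))
        show "marked (decode k (Long ?b ds # cs)) = marked P"
          unfolding decode_simps marks.simps ds(1) mk mk' P(2)[symmetric] Un_assoc Int_Un_distrib[symmetric]
          using j(1) by (intro M_split) auto
        have "(L |` {k<..<j} ++ L |` {j..}) i = L i" for i
          using dom_ge[of i] dom_k False
          by (cases "L i"; cases "i = k") (auto simp: restrict_map_def map_add_def)
        then show "arc_label (decode k (Long ?b ds # cs)) = arc_label P"
          unfolding decode_simps labels.simps ds(1) lb lb' by (simp add: fun_eq_iff flip: P(3))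
      qed simp
      then show ?thesis using cs ds by (intro exI[of _ "Long ?b ds # cs"]) simp
    qed
  qed
qed

lemma mNC_star_eq: "mNC_star (Suc (length \<nu>)) \<nu> = decode 1 ` chains \<nu>"
proof (intro equalityI subsetI)
  fix P assume P: "P \<in> mNC_star (Suc (length \<nu>)) \<nu>"
  then obtain cs where "decode 1 cs = P"
    using decode_surj[of P 1 "Suc (Suc (length \<nu>))"] by (auto simp: mNC_star_def aug_interlacing_eq)
  then show "P \<in> decode 1 ` chains \<nu>"
    using P by (auto simp: mNC_star_def chains_def aug_word_decode)
next
  fix P assume "P \<in> decode 1 ` chains \<nu>"
  then show "P \<in> mNC_star (Suc (length \<nu>)) \<nu>"
    using decode_in_aug_on[of 1]
    by (auto simp: mNC_star_def chains_def aug_word_decode aug_interlacing_eq chain_size_eq)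
qed

section \<open>Weights\<close>

lemma prod_if_mem:
  "finite A \<Longrightarrow> (\<Prod>i\<in>A. if i \<in> M then a else b) = a ^ card (A \<inter> M) * b ^ card (A - M)"
  by (simp add: prod.If_cases Diff_eq)

text \<open>Exponents that count arcs become a product with one factor per arc, which can be split
  along a chain. A jumper has the weights of a \<open>D\<close> and a \<open>U\<close> arc together,
  both governed by its one mark.\<close>

lemma aug_weight_eq_prod:
  assumes "dom (arc_label P) = steppers (blocks P)"
    and "finite (steppers (blocks P))" "finite (jumpers (blocks P))"
  shows "aug_weight P = (\<Prod>i \<in> steppers (blocks P). short_wt (i \<in> marked P) (the (arc_label P i)))
    * (\<Prod>i \<in> jumpers (blocks P). short_wt (i \<in> marked P) D * short_wt (i \<in> marked P) U)"
proof -
  let ?A = "short_arcs P" and ?M = "marked P"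
  have un: "steppers (blocks P) = ?A U \<union> ?A D"
  proof (intro equalityI subsetI)
    fix i assume i: "i \<in> steppers (blocks P)"
    then obtain c where "arc_label P i = Some c" using assms(1) by blast
    then show "i \<in> ?A U \<union> ?A D" using i by (cases c) (auto simp: short_arcs_def)
  qed (auto simp: short_arcs_def)
  have fin: "finite (?A c)" for c using assms(2) by (simp add: short_arcs_def)
  have "(\<Prod>i \<in> steppers (blocks P). short_wt (i \<in> ?M) (the (arc_label P i))) =
      (\<Prod>i \<in> ?A U. short_wt (i \<in> ?M) (the (arc_label P i)))
      * (\<Prod>i \<in> ?A D. short_wt (i \<in> ?M) (the (arc_label P i)))"
    unfolding un using fin by (intro prod.union_disjoint) (auto simp: short_arcs_def)
  moreover have "(\<Prod>i \<in> ?A U. short_wt (i \<in> ?M) (the (arc_label P i))) =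
      (\<Prod>i \<in> ?A U. if i \<in> ?M then mvar Lambda else mvar Lambda_bar)"
    by (intro prod.cong) (auto simp: short_arcs_def)
  moreover have "(\<Prod>i \<in> ?A D. short_wt (i \<in> ?M) (the (arc_label P i))) =
      (\<Prod>i \<in> ?A D. if i \<in> ?M then mvar Rho else mvar Rho_bar)"
    by (intro prod.cong) (auto simp: short_arcs_def)
  moreover have "(\<Prod>i \<in> jumpers (blocks P). short_wt (i \<in> ?M) D * short_wt (i \<in> ?M) U) =
      (\<Prod>i \<in> jumpers (blocks P). if i \<in> ?M then mvar Lambda * mvar Rho else mvar Lambda_bar * mvar Rho_bar)"
    by (intro prod.cong) (auto simp: mult.commute)
  ultimately show ?thesis
    by (simp add: aug_weight_def prod_if_mem fin assms(3) mult_ac)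
qed

lemma finite_steppers: "finite (steppers (all_blocks k cs))"
  by (induction k cs rule: inner_blocks.induct) (simp_all add: steppers_all_blocks)

lemma finite_jumpers: "finite (jumpers (all_blocks k cs))"
  by (induction k cs rule: inner_blocks.induct) (simp_all add: jumpers_all_blocks)

definition step_prod :: "nat \<Rightarrow> arc list \<Rightarrow> series" where
  "step_prod k cs = (\<Prod>i \<in> steppers (all_blocks k cs). short_wt (i \<in> marks k cs) (the (labels k cs i)))"

definition jump_prod :: "nat \<Rightarrow> arc list \<Rightarrow> series" where
  "jump_prod k cs = (\<Prod>i \<in> jumpers (all_blocks k cs).
     short_wt (i \<in> marks k cs) D * short_wt (i \<in> marks k cs) U)"

lemma aug_weight_decode: "aug_weight (decode k cs) = step_prod k cs * jump_prod k cs"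
  by (simp add: aug_weight_eq_prod dom_labels finite_steppers finite_jumpers step_prod_def jump_prod_def)

lemma marks_Short_iff: "Suc k \<le> i \<Longrightarrow> i \<in> marks k (Short b c # cs) \<longleftrightarrow> i \<in> marks (Suc k) cs"
  by auto

lemma marks_Long_iff:
  "Suc k \<le> i \<Longrightarrow> i < Suc k + chain_size ds \<Longrightarrow> i \<in> marks k (Long b ds # cs) \<longleftrightarrow> i \<in> marks (Suc k) ds"
  "Suc k + chain_size ds \<le> i \<Longrightarrow>
    i \<in> marks k (Long b ds # cs) \<longleftrightarrow> i \<in> marks (Suc k + chain_size ds) cs"
  using marks_range[of "Suc k" ds] marks_range[of "Suc k + chain_size ds" cs] by auto

lemma labels_Long_eq:
  "i < Suc k + chain_size ds \<Longrightarrow> labels k (Long b ds # cs) i = labels (Suc k) ds i"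
  "Suc k + chain_size ds \<le> i \<Longrightarrow> labels k (Long b ds # cs) i = labels (Suc k + chain_size ds) cs i"
proof -
  assume "i < Suc k + chain_size ds"
  then have "i \<notin> dom (labels (Suc k + chain_size ds) cs)"
    using labels_range[of i "Suc k + chain_size ds" cs] by auto
  then show "labels k (Long b ds # cs) i = labels (Suc k) ds i"
    by (simp add: map_add_dom_app_simps)
next
  assume "Suc k + chain_size ds \<le> i"
  then have "i \<notin> dom (labels (Suc k) ds)"
    using labels_range[of i "Suc k" ds] by auto
  then show "labels k (Long b ds # cs) i = labels (Suc k + chain_size ds) cs i"
    by (simp add: map_add_dom_app_simps)
qed

lemma step_prod_Short: "step_prod k (Short b c # cs) = short_wt b c * step_prod (Suc k) cs"
proof -
  have "k \<notin> steppers (all_blocks (Suc k) cs)" using steppers_range by fastforce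
  moreover have "(\<Prod>i \<in> steppers (all_blocks (Suc k) cs).
      short_wt (i \<in> marks k (Short b c # cs)) (the (labels k (Short b c # cs) i))) = step_prod (Suc k) cs"
    unfolding step_prod_def
  proof (rule prod.cong[OF refl])
    fix i assume "i \<in> steppers (all_blocks (Suc k) cs)"
    then have "Suc k \<le> i" using steppers_range by blast
    then show "short_wt (i \<in> marks k (Short b c # cs)) (the (labels k (Short b c # cs) i)) =
        short_wt (i \<in> marks (Suc k) cs) (the (labels (Suc k) cs i))"
      unfolding marks_Short_iff[OF \<open>Suc k \<le> i\<close>] by simp
  qed
  ultimately show ?thesis
    unfolding step_prod_def[of k] steppers_all_blocks
    by (subst prod.insert) (simp_all add: finite_steppers start_in_marks del: marks.simps)
qed

lemma jump_prod_Short: "jump_prod k (Short b c # cs) = jump_prod (Suc k) cs"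
  unfolding jump_prod_def jumpers_all_blocks
proof (rule prod.cong[OF refl])
  fix i assume "i \<in> jumpers (all_blocks (Suc k) cs)"
  then have "Suc k \<le> i" using jumpers_range by blast
  then show "short_wt (i \<in> marks k (Short b c # cs)) D * short_wt (i \<in> marks k (Short b c # cs)) U =
    short_wt (i \<in> marks (Suc k) cs) D * short_wt (i \<in> marks (Suc k) cs) U"
    by (simp only: marks_Short_iff)
qed

lemma step_prod_Long:
  "step_prod k (Long b ds # cs) = step_prod (Suc k) ds * step_prod (Suc k + chain_size ds) cs"
proof -
  let ?j = "Suc k + chain_size ds"
  let ?g = "\<lambda>i. short_wt (i \<in> marks k (Long b ds # cs)) (the (labels k (Long b ds # cs) i))"
  have "prod ?g (steppers (all_blocks (Suc k) ds)) = step_prod (Suc k) ds"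
    unfolding step_prod_def
  proof (rule prod.cong[OF refl])
    fix i assume "i \<in> steppers (all_blocks (Suc k) ds)"
    then have "Suc k \<le> i" "i < ?j" using steppers_range[of i "Suc k" ds] by auto
    then show "?g i = short_wt (i \<in> marks (Suc k) ds) (the (labels (Suc k) ds i))"
      by (simp only: marks_Long_iff labels_Long_eq)
  qed
  moreover have "prod ?g (steppers (all_blocks ?j cs)) = step_prod ?j cs"
    unfolding step_prod_def
  proof (rule prod.cong[OF refl])
    fix i assume "i \<in> steppers (all_blocks ?j cs)"
    then have "?j \<le> i" using steppers_range[of i ?j cs] by auto
    then show "?g i = short_wt (i \<in> marks ?j cs) (the (labels ?j cs i))"
      by (simp only: marks_Long_iff labels_Long_eq)
  qed
  moreover have "steppers (all_blocks (Suc k) ds) \<inter> steppers (all_blocks ?j cs) = {}"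
    using steppers_range[of _ "Suc k" ds] steppers_range[of _ ?j cs] by fastforce
  ultimately show ?thesis
    unfolding step_prod_def[of k] steppers_all_blocks
    by (simp only: prod.union_disjoint finite_steppers)
qed

lemma jump_prod_Long:
  "jump_prod k (Long b ds # cs) =
    short_wt b D * short_wt b U * (jump_prod (Suc k) ds * jump_prod (Suc k + chain_size ds) cs)"
proof -
  let ?j = "Suc k + chain_size ds"
  let ?g = "\<lambda>i. short_wt (i \<in> marks k (Long b ds # cs)) D * short_wt (i \<in> marks k (Long b ds # cs)) U"
  have "prod ?g (jumpers (all_blocks (Suc k) ds)) = jump_prod (Suc k) ds"
    unfolding jump_prod_def
  proof (rule prod.cong[OF refl])
    fix i assume "i \<in> jumpers (all_blocks (Suc k) ds)"
    then have "Suc k \<le> i" "i < ?j" using jumpers_range[of i "Suc k" ds] by auto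
    then show "?g i = short_wt (i \<in> marks (Suc k) ds) D * short_wt (i \<in> marks (Suc k) ds) U"
      by (simp only: marks_Long_iff)
  qed
  moreover have "prod ?g (jumpers (all_blocks ?j cs)) = jump_prod ?j cs"
    unfolding jump_prod_def
  proof (rule prod.cong[OF refl])
    fix i assume "i \<in> jumpers (all_blocks ?j cs)"
    then have "?j \<le> i" using jumpers_range[of i ?j cs] by auto
    then show "?g i = short_wt (i \<in> marks ?j cs) D * short_wt (i \<in> marks ?j cs) U"
      by (simp only: marks_Long_iff)
  qed
  moreover have "jumpers (all_blocks (Suc k) ds) \<inter> jumpers (all_blocks ?j cs) = {}"
    using jumpers_range[of _ "Suc k" ds] jumpers_range[of _ ?j cs] by fastforce
  moreover have "k \<notin> jumpers (all_blocks (Suc k) ds) \<union> jumpers (all_blocks ?j cs)"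
    using jumpers_range[of k "Suc k" ds] jumpers_range[of k ?j cs] by auto
  moreover have "?g k = short_wt b D * short_wt b U" by (simp only: start_in_marks)
  ultimately show ?thesis
    unfolding jump_prod_def[of k] jumpers_all_blocks
    by (simp only: prod.insert prod.union_disjoint finite_jumpers finite_UnI simp_thms)
qed


section \<open>Ribbons of blocks\<close>

text \<open>The composition of \<open>length bs + 1\<close> whose partial sums are the positions,
  counted from 1, of \<open>True\<close> in \<open>bs\<close>. A \<open>False\<close> in front
  enlarges the first part, a \<open>True\<close> starts a new one.\<close>

fun pattern_comp :: "bool list \<Rightarrow> nat list" where
  "pattern_comp [] = [1]"
| "pattern_comp (True # bs) = 1 # pattern_comp bs"
| "pattern_comp (False # bs) = Suc (hd (pattern_comp bs)) # tl (pattern_comp bs)"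

lemma break_after_cong:
  "(\<And>x. x \<in> set xs \<Longrightarrow> Q x = Q' x) \<Longrightarrow> break_after Q xs = break_after Q' xs"
  by (induction xs rule: induct_list012) auto

text \<open>Allows a block to be evaluated in the decoding of the subchain it comes from instead of
  the whole chain.\<close>

lemma block_comp_cong:
  assumes "marked P \<inter> B = marked P' \<inter> B"
  shows "block_comp P B = block_comp P' B"
proof -
  have "set (sorted_list_of_set B) \<subseteq> B" by (cases "finite B") auto
  then show ?thesis
    using assms unfolding block_comp_def by (intro arg_cong[of _ _ "map length"] break_after_cong) blast
qed

lemma pattern_comp_nonempty: "pattern_comp bs \<noteq> []"
  by (cases bs rule: pattern_comp.cases) auto

lemma break_after_Cons: "xs \<noteq> [] \<Longrightarrow> break_after Q (x # xs) =
    (if Q x then [x] # break_after Q xs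
     else (x # hd (break_after Q xs)) # tl (break_after Q xs))"
  by (cases xs) auto

lemma spine_nonempty: "spine k cs \<noteq> []"
  using spine_hd[of k cs] by auto

lemma block_comp_spine: "block_comp (decode k cs) (set (spine k cs)) = pattern_comp (map mark cs)"
proof -
  have "map length (break_after (\<lambda>i. i \<in> marks k cs) (spine k cs)) = pattern_comp (map mark cs)"
  proof (induction k cs rule: inner_blocks.induct)
    case (2 k b c cs)
    let ?xs = "spine (Suc k) cs"
    have "break_after (\<lambda>i. i \<in> marks k (Short b c # cs)) ?xs = break_after (\<lambda>i. i \<in> marks (Suc k) cs) ?xs"
      using spine_range[of "Suc k" cs] by (intro break_after_cong) (auto dest!: subsetD)
    moreover have "break_after (\<lambda>i. i \<in> marks (Suc k) cs) ?xs \<noteq> []"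
      by (rule break_after_nonempty[OF spine_nonempty])
    ultimately show ?case
      using 2 start_in_marks(1)[of k b c cs]
      by (cases b) (simp_all add: break_after_Cons spine_nonempty hd_map map_tl del: marks.simps flip: 2)
  next
    case (3 k b ds cs)
    let ?j = "Suc k + chain_size ds"
    let ?xs = "spine ?j cs"
    have "break_after (\<lambda>i. i \<in> marks k (Long b ds # cs)) ?xs = break_after (\<lambda>i. i \<in> marks ?j cs) ?xs"
    proof (rule break_after_cong)
      fix x assume "x \<in> set ?xs"
      then have "?j \<le> x" using spine_range[of ?j cs] by auto
      then show "(x \<in> marks k (Long b ds # cs)) = (x \<in> marks ?j cs)" by (rule marks_Long_iff(2))
    qed
    moreover have "break_after (\<lambda>i. i \<in> marks ?j cs) ?xs \<noteq> []"
      by (rule break_after_nonempty[OF spine_nonempty])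
    ultimately show ?case
      using 3 start_in_marks(2)[of k b ds cs]
      by (cases b) (simp_all add: break_after_Cons spine_nonempty hd_map map_tl del: marks.simps flip: 3(2))
  qed simp
  then show ?thesis by (simp add: block_comp_def sorted_list_of_spine)
qed

lemma comp_set_Cons: "comp_set (a # \<alpha>) = (if \<alpha> = [] then {} else insert a ((+) a ` comp_set \<alpha>))"
proof (cases "\<alpha> = []")
  case False
  show ?thesis
  proof (intro equalityI subsetI)
    fix x assume "x \<in> comp_set (a # \<alpha>)"
    then obtain i where i: "1 \<le> i" "i < length (a # \<alpha>)" "x = sum_list (take i (a # \<alpha>))"
      by (auto simp: comp_set_def)
    then obtain i' where i': "i = Suc i'" by (cases i) auto
    show "x \<in> (if \<alpha> = [] then {} else insert a ((+) a ` comp_set \<alpha>))"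
    proof (cases "i' = 0")
      case False
      then have "sum_list (take i' \<alpha>) \<in> comp_set \<alpha>"
        using i(2) i' unfolding comp_set_def by (intro CollectI exI[of _ i']) simp
      then show ?thesis using \<open>\<alpha> \<noteq> []\<close> i(3) i' by simp
    qed (use i i' False in simp)
  next
    fix x assume "x \<in> (if \<alpha> = [] then {} else insert a ((+) a ` comp_set \<alpha>))"
    then consider "x = a" | i where "1 \<le> i" "i < length \<alpha>" "x = a + sum_list (take i \<alpha>)"
      using False by (auto simp: comp_set_def)
    then show "x \<in> comp_set (a # \<alpha>)"
    proof cases
      case 1
      then show ?thesis using False unfolding comp_set_def by (auto intro!: exI[of _ 1])
    next
      case 2
      then show ?thesis unfolding comp_set_def by (auto intro!: exI[of _ "Suc i"])
    qed
  qed
qed (auto simp: comp_set_def)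

lemma comp_set_pattern_comp: "comp_set (pattern_comp bs) = Suc ` {i. i < length bs \<and> bs ! i}"
proof (induction bs rule: pattern_comp.induct)
  case (2 bs)
  have "{i. i < length (True # bs) \<and> (True # bs) ! i} = insert 0 (Suc ` {i. i < length bs \<and> bs ! i})"
    by (auto simp: less_Suc_eq_0_disj)
  then show ?case using 2 pattern_comp_nonempty[of bs] by (simp add: comp_set_Cons)
next
  case (3 bs)
  obtain a \<alpha> where a: "pattern_comp bs = a # \<alpha>" using pattern_comp_nonempty by (metis list.exhaust)
  have "{i. i < length (False # bs) \<and> (False # bs) ! i} = Suc ` {i. i < length bs \<and> bs ! i}"
    by (auto simp: less_Suc_eq_0_disj)
  moreover have "comp_set (Suc a # \<alpha>) = Suc ` comp_set (a # \<alpha>)"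
    by (auto simp: comp_set_Cons image_image)
  ultimately show ?case using 3 a by simp
qed (simp add: comp_set_def)

lemma sum_list_pattern_comp: "sum_list (pattern_comp bs) = Suc (length bs)"
proof (induction bs rule: pattern_comp.induct)
  case (3 bs)
  then show ?case using pattern_comp_nonempty[of bs] by (cases "pattern_comp bs") auto
qed simp_all

lemma descent_set_eq_pattern:
  assumes "length w = Suc (length bs)"
  shows "descent_set w = comp_set (pattern_comp bs) \<longleftrightarrow> (\<forall>i < length bs. bs ! i \<longleftrightarrow> w ! Suc i < w ! i)"
proof -
  have "descent_set w = Suc ` {i. i < length bs \<and> w ! Suc i < w ! i}"
  proof (intro equalityI subsetI)
    fix x assume "x \<in> descent_set w"
    then show "x \<in> Suc ` {i. i < length bs \<and> w ! Suc i < w ! i}"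
      using assms by (cases x) (auto simp: descent_set_def)
  qed (auto simp: descent_set_def assms)
  then show ?thesis unfolding comp_set_pattern_comp by (auto simp: inj_image_eq_iff)
qed

section \<open>Truncation of both sides and factorization of the ribbon product\<close>

lemma restrict_vars_mvar: "restrict_vars V (mvar v) = (if v \<in> V then mvar v else 0)"
  by (simp add: mvar_def restrict_vars_mmonom)

lemma restrict_vars_word:
  "restrict_vars (vars_upto N) (\<Prod>a\<leftarrow>w. mvar (X a)) = (if set w \<subseteq> {..N} then \<Prod>a\<leftarrow>w. mvar (X a) else 0)"
proof -
  have "set_mset (mset (map X w)) \<subseteq> vars_upto N \<longleftrightarrow> set w \<subseteq> {..N}"
    by (auto simp: vars_upto_def)
  then show ?thesis by (simp add: prod_list_mvar restrict_vars_mmonom)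
qed

lemma restrict_vars_ribbon: "restrict_vars (vars_upto N) (ribbon (pattern_comp bs)) = ribbon_upto N bs"
proof -
  let ?A = "{w. length w = sum_list (pattern_comp bs) \<and> (\<forall>a \<in> set w. 0 < a) \<and>
    descent_set w = comp_set (pattern_comp bs)}"
  \<comment> \<open>Positivity of the letters comes from \<open>ribbon\<close>, the upper bound
    \<open>N\<close> from the truncation.\<close>
  have "set w \<subseteq> {1..N} \<longleftrightarrow> (\<forall>a \<in> set w. 0 < a) \<and> set w \<subseteq> {..N}" for w
    by (auto simp: Suc_le_eq subset_iff)
  then have iff: "w \<in> pattern_words N bs \<longleftrightarrow> w \<in> ?A \<and> set w \<subseteq> {..N}" for w
    using descent_set_eq_pattern[of w bs]
    unfolding pattern_words_def by (auto simp: sum_list_pattern_comp)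
  have "restrict_vars (vars_upto N) (ribbon (pattern_comp bs)) =
      (\<Sum>w \<in> pattern_words N bs. restrict_vars (vars_upto N) (\<Prod>a\<leftarrow>w. mvar (X a)))"
    unfolding ribbon_def
    by (rule restrict_vars_mfps_sum) (use iff in \<open>auto simp: finite_pattern_words restrict_vars_word\<close>)
  also have "\<dots> = ribbon_upto N bs"
    unfolding ribbon_upto_def by (rule sum.cong) (use iff in \<open>auto simp: restrict_vars_word\<close>)
  finally show ?thesis .
qed

definition inner_prod :: "nat \<Rightarrow> nat \<Rightarrow> arc list \<Rightarrow> series" where
  "inner_prod N k cs = (\<Prod>B \<in> inner_blocks k cs.
     restrict_vars (vars_upto N) (ribbon (block_comp (decode k cs) B)))"

lemma finite_inner_blocks: "finite (inner_blocks k cs)"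
  by (induction k cs rule: inner_blocks.induct) simp_all

lemma prod_all_blocks:
  "(\<Prod>B \<in> all_blocks k cs. restrict_vars (vars_upto N) (ribbon (block_comp (decode k cs) B))) =
    ribbon_upto N (map mark cs) * inner_prod N k cs"
  unfolding all_blocks_def inner_prod_def
  by (subst prod.insert)
     (simp_all add: finite_inner_blocks spine_notin_inner block_comp_spine restrict_vars_ribbon)

lemma inner_prod_Short: "inner_prod N k (Short b c # cs) = inner_prod N (Suc k) cs"
  unfolding inner_prod_def inner_blocks.simps
proof (rule prod.cong[OF refl])
  fix B assume "B \<in> inner_blocks (Suc k) cs"
  then have "B \<subseteq> {Suc k..}" using inner_blocks_range[of B "Suc k" cs] by fastforce
  then have "block_comp (decode k (Short b c # cs)) B = block_comp (decode (Suc k) cs) B"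
    by (intro block_comp_cong) auto
  then show "restrict_vars (vars_upto N) (ribbon (block_comp (decode k (Short b c # cs)) B)) =
      restrict_vars (vars_upto N) (ribbon (block_comp (decode (Suc k) cs) B))" by simp
qed

lemma inner_prod_Long: "inner_prod N k (Long b ds # cs) =
    ribbon_upto N (map mark ds) * inner_prod N (Suc k) ds * inner_prod N (Suc k + chain_size ds) cs"
proof -
  let ?j = "Suc k + chain_size ds" and ?P = "decode k (Long b ds # cs)"
  let ?r = "\<lambda>P B. restrict_vars (vars_upto N) (ribbon (block_comp P B))"
  have 1: "prod (?r ?P) (all_blocks (Suc k) ds) = ribbon_upto N (map mark ds) * inner_prod N (Suc k) ds"
    unfolding prod_all_blocks[symmetric]
  proof (rule prod.cong[OF refl])
    fix B assume "B \<in> all_blocks (Suc k) ds"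
    then have "B \<subseteq> {Suc k..<?j}" using all_blocks_range by blast
    then have "block_comp ?P B = block_comp (decode (Suc k) ds) B"
      using marks_Long_iff(1)[of k _ ds b cs] by (intro block_comp_cong) fastforce
    then show "?r ?P B = ?r (decode (Suc k) ds) B" by simp
  qed
  have 2: "prod (?r ?P) (inner_blocks ?j cs) = inner_prod N ?j cs"
    unfolding inner_prod_def
  proof (rule prod.cong[OF refl])
    fix B assume "B \<in> inner_blocks ?j cs"
    then have "B \<subseteq> {?j..}" using inner_blocks_range[of B ?j cs] by fastforce
    then have "block_comp ?P B = block_comp (decode ?j cs) B"
      using marks_Long_iff(2)[of k ds _ b cs] by (intro block_comp_cong) fastforce
    then show "?r ?P B = ?r (decode ?j cs) B" by simp
  qed
  have disj: "all_blocks (Suc k) ds \<inter> inner_blocks ?j cs = {}"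
  proof (intro equalityI subsetI)
    fix B assume "B \<in> all_blocks (Suc k) ds \<inter> inner_blocks ?j cs"
    then have "B \<noteq> {}" "B \<subseteq> {Suc k..<?j}" "B \<subseteq> {?j<..<?j + chain_size cs}"
      using all_blocks_range inner_blocks_range by blast+
    then show "B \<in> {}" by fastforce
  qed simp
  have "inner_blocks k (Long b ds # cs) = all_blocks (Suc k) ds \<union> inner_blocks ?j cs"
    by (simp add: all_blocks_def)
  then have "inner_prod N k (Long b ds # cs) =
      prod (?r ?P) (all_blocks (Suc k) ds) * prod (?r ?P) (inner_blocks ?j cs)"
    unfolding inner_prod_def
    using prod.union_disjoint[OF _ finite_inner_blocks disj] by (simp add: all_blocks_def finite_inner_blocks)
  then show ?thesis unfolding 1 2 .
qed

lemma arcs_wt_eq: "step_prod k cs * jump_prod k cs * inner_prod N k cs = arcs_wt N cs"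
proof (induction k cs rule: inner_blocks.induct)
  case (1 k)
  show ?case
    by (simp add: step_prod_def jump_prod_def inner_prod_def steppers_all_blocks jumpers_all_blocks)
next
  case (2 k b c cs)
  show ?case
    unfolding step_prod_Short jump_prod_Short inner_prod_Short arcs_wt.simps 2[symmetric]
    by (simp only: mult_ac)
next
  case (3 k b ds cs)
  show ?case
    unfolding step_prod_Long jump_prod_Long inner_prod_Long arcs_wt.simps 3[symmetric]
    by (simp only: mult_ac)
qed

lemma aug_weight_prod_ribbon_decode:
  "aug_weight (decode k cs) * (\<Prod>B \<in> blocks (decode k cs).
      restrict_vars (vars_upto N) (ribbon (block_comp (decode k cs) B))) =
    arcs_wt N cs * ribbon_upto N (map mark cs)"
  unfolding arcs_wt_eq[of k cs N, symmetric] aug_weight_decode decode_simps prod_all_blocks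
  by (simp only: mult_ac)

lemma restrict_vars_aug_weight: "restrict_vars (vars_upto N) (aug_weight P) = aug_weight P"
  by (simp add: aug_weight_def restrict_vars_mult restrict_vars_power restrict_vars_mvar vars_upto_def)

lemma restrict_vars_tree_weight: "restrict_vars (vars_upto N) (tree_weight T) =
    (if set_tree T \<subseteq> {..N} then tree_weight T else 0)"
  by (simp add: tree_weight_def restrict_vars_mult restrict_vars_power restrict_vars_mvar
      restrict_vars_word) (simp add: vars_upto_def)

lemma restrict_vars_tree_gf:
  "restrict_vars (vars_upto N) (tree_gf (Suc (length \<nu>)) \<nu>) = (\<Sum>T \<in> trees N \<nu>. tree_weight T)"
proof -
  let ?A = "{T \<in> labeled_trees (Suc (length \<nu>)). canopy T = \<nu>}"
  have pos: "set_tree T \<subseteq> {1..N} \<longleftrightarrow> (\<forall>a \<in> set_tree T. 0 < a) \<and> set_tree T \<subseteq> {..N}" for T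
    by (auto simp: Suc_le_eq subset_iff)
  have iff: "T \<in> trees N \<nu> \<longleftrightarrow> T \<in> ?A \<and> set_tree T \<subseteq> {..N}" for T
    unfolding trees_def mem_Collect_eq pos using length_canopy[of T]
    by (auto simp: labeled_trees_def)
  have "restrict_vars (vars_upto N) (tree_gf (Suc (length \<nu>)) \<nu>) =
      (\<Sum>T \<in> trees N \<nu>. restrict_vars (vars_upto N) (tree_weight T))"
    unfolding tree_gf_def
    by (rule restrict_vars_mfps_sum) (use iff in \<open>auto simp: finite_trees_canopy restrict_vars_tree_weight\<close>)
  also have "\<dots> = (\<Sum>T \<in> trees N \<nu>. tree_weight T)"
    by (rule sum.cong) (use iff in \<open>auto simp: restrict_vars_tree_weight\<close>)
  finally show ?thesis .
qed

theorem theorem1p6: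
  fixes n :: nat and \<nu> :: "letter list"
  assumes "n \<ge> 1" and "length \<nu> = n - 1"
  shows "tree_gf n \<nu> =
    (\<Sum>P \<in> mNC_star n \<nu>. aug_weight P * (\<Prod>B \<in> blocks P. ribbon (block_comp P B)))"
proof (rule eq_if_restrict_vars_eq)
  fix N
  let ?\<rho> = "restrict_vars (vars_upto N)"
  have n: "n = Suc (length \<nu>)" using assms by simp
  have inj: "inj_on (decode 1) (chains \<nu>)" by (auto simp: inj_on_def dest: decode_inject)
  \<comment> \<open>The truncation passes through the sum and the products and fixes
    \<open>aug_weight P\<close>, whose four indeterminates are kept; only the ribbons
    change.\<close>
  have "?\<rho> (\<Sum>P \<in> mNC_star n \<nu>. aug_weight P * (\<Prod>B \<in> blocks P. ribbon (block_comp P B))) =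
      (\<Sum>P \<in> mNC_star n \<nu>. aug_weight P * (\<Prod>B \<in> blocks P. ?\<rho> (ribbon (block_comp P B))))"
    by (simp add: restrict_vars_sum restrict_vars_mult restrict_vars_prod restrict_vars_aug_weight)
  also have "\<dots> = (\<Sum>cs \<in> chains \<nu>. arcs_wt N cs * ribbon_upto N (map mark cs))"
    unfolding n mNC_star_eq sum.reindex[OF inj] o_def aug_weight_prod_ribbon_decode ..
  also have "\<dots> = ?\<rho> (tree_gf n \<nu>)"
    unfolding n restrict_vars_tree_gf sum_trees_eq_sum_chains ..
  finally show "?\<rho> (tree_gf n \<nu>) = ?\<rho> (\<Sum>P \<in> mNC_star n \<nu>. aug_weight P * (\<Prod>B \<in> blocks P. ribbon (block_comp P B)))" ..
qed

end
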